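(* Let $P(t)=\sum_{j=1}^{r}\binom{t+b_j-(j-1)}{b_j}$ be an admissible Hilbert polynomial, written in its Gotzmann expression with integers $b_1\ge b_2\ge\dots\ge b_r\ge 0$, let $c$ be a positive integer, and let $n:=c+\deg P$. Let $s$ be the integer with $b_1=b_2=\dots=b_s>b_{s+1}\ge\dots\ge b_r$ (so $s=r$ if all $b_j$ are equal). Then the lexicographic ideal $L^{P}_n\subset\Bbbk[x_0,\dots,x_n]$ is the unique saturated Borel ideal of $\Bbbk[x_0,\dots,x_n]$ (i.e. the unique saturated Borel ideal of codimension $c$) with Hilbert polynomial $P$ if and only if one of the following holds: (i) $c\ge 2$ and either $b_r>0$ or $r\le 2$; or (ii) $c=1$ and either $b_r>0$, or $b_1=b_r$, or $r-s\le 2$.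
   Context: $\Bbbk$ is an algebraically closed field and $\Bbbk[x_0,\dots,x_n]$ is the standard graded polynomial ring. For a homogeneous ideal $I$, $P_I$ denotes the Hilbert polynomial of $\Bbbk[x_0,\dots,x_n]/I$. Binomial coefficients are polynomials in $t$: for integers $a,b$, $\binom{t+a}{b}=\frac{(t+a)(t+a-1)\cdots(t+a-b+1)}{b!}$ if $b\ge 0$ and $0$ if $b<0$. A polynomial is an admissible Hilbert polynomial if it is the Hilbert polynomial of a nonempty closed subscheme of some projective space; each such $P$ has a unique Gotzmann expression $P(t)=\sum_{j=1}^r\binom{t+b_j-(j-1)}{b_j}$ with $b_1\ge\dots\ge b_r\ge 0$ (then $\deg P=b_1$). A monomial ideal $I$ is Borel if for every monomial $m\in I$, every variable $x_j$ dividing $m$ and every $i<j$, we have $m x_i/x_j\in I$. $I$ is saturated if $(I:\langle x_0,\dots,x_n\rangle^\infty)=I$. Lexicographic order on monomials: $x^u>x^v$ if the first nonzero coordinate of $u-v$ is positive (so $x_0>x_1>\dots>x_n$). For a homogeneous ideal $I\subseteq\Bbbk[x_0,\dots,x_n]$ with Hilbert function $H$, let $L^H_n$ be the monomial ideal whose degree-$i$ piece is spanned by the $\dim_\Bbbk I_i$ lexicographically largest monomials of degree $i$; for an admissible Hilbert polynomial $P$ with $\deg P<n$, the lexicographic ideal $L^P_n$ is the saturation of $L^{H_I}_n$ with respect to $\langle x_0,\dots,x_n\rangle$ for any homogeneous ideal $I$ with Hilbert polynomial $P$ (it depends only on $P$ and $n$, and has Hilbert polynomial $P$). The codimension of an ideal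 of $\Bbbk[x_0,\dots,x_n]$ with Hilbert polynomial $P$ is $n-\deg P$. *)

theory Defs
  imports Complex_Main
begin

text \<open>Monomials of k[x_0,...,x_n] are exponent vectors nat => nat supported in {0..n}.
 A monomial ideal is represented by the set of monomials it contains.\<close>

definition mons :: "nat \<Rightarrow> (nat \<Rightarrow> nat) set" where
  "mons n = {u. \<forall>i>n. u i = 0}"

definition mdeg :: "nat \<Rightarrow> (nat \<Rightarrow> nat) \<Rightarrow> nat" where
  "mdeg n u = (\<Sum>i\<le>n. u i)"

definition mons_deg :: "nat \<Rightarrow> nat \<Rightarrow> (nat \<Rightarrow> nat) set" where
  "mons_deg n d = {u \<in> mons n. mdeg n u = d}"

definition mono_ideal :: "nat \<Rightarrow> (nat \<Rightarrow> nat) set \<Rightarrow> bool" where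
  "mono_ideal n I \<longleftrightarrow> I \<subseteq> mons n \<and> (\<forall>u\<in>I. \<forall>v\<in>mons n. (\<lambda>i. u i + v i) \<in> I)"

definition borel :: "nat \<Rightarrow> (nat \<Rightarrow> nat) set \<Rightarrow> bool" where
  "borel n I \<longleftrightarrow> (\<forall>u\<in>I. \<forall>i j. i < j \<and> j \<le> n \<and> 0 < u j \<longrightarrow>
      u(i := u i + 1, j := u j - 1) \<in> I)"

definition saturation :: "nat \<Rightarrow> (nat \<Rightarrow> nat) set \<Rightarrow> (nat \<Rightarrow> nat) set" where
  "saturation n I = {u \<in> mons n. \<exists>k. \<forall>w\<in>mons_deg n k. (\<lambda>i. u i + w i) \<in> I}"

definition saturated :: "nat \<Rightarrow> (nat \<Rightarrow> nat) set \<Rightarrow> bool" where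
  "saturated n I \<longleftrightarrow> saturation n I = I"

definition hilb_fun :: "nat \<Rightarrow> (nat \<Rightarrow> nat) set \<Rightarrow> nat \<Rightarrow> nat" where
  "hilb_fun n I d = card (mons_deg n d - I)"

text \<open>Gotzmann expression: b = [b_1,...,b_r] (0-indexed list),
  P(t) = sum_{j=1}^r binom(t + b_j - (j-1), b_j).\<close>
definition gotzmann :: "nat list \<Rightarrow> real \<Rightarrow> real" where
  "gotzmann b t = (\<Sum>j<length b. (t + real (b ! j) - real j) gchoose (b ! j))"

definition has_hilb_poly :: "nat \<Rightarrow> (nat \<Rightarrow> nat) set \<Rightarrow> (real \<Rightarrow> real) \<Rightarrow> bool" where
  "has_hilb_poly n I P \<longleftrightarrow> (\<forall>\<^sub>F d in sequentially. real (hilb_fun n I d) = P (real d))"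

definition lex_gt :: "(nat \<Rightarrow> nat) \<Rightarrow> (nat \<Rightarrow> nat) \<Rightarrow> bool" where
  "lex_gt u v \<longleftrightarrow> (\<exists>i. (\<forall>k<i. u k = v k) \<and> v i < u i)"

definition lexify :: "nat \<Rightarrow> (nat \<Rightarrow> nat) set \<Rightarrow> (nat \<Rightarrow> nat) set" where
  "lexify n I = {m. \<exists>d. m \<in> mons_deg n d \<and>
      card {v \<in> mons_deg n d. lex_gt v m} < card (mons_deg n d \<inter> I)}"

text \<open>L^P_n: saturation of L^{H_I}_n for an ideal I with Hilbert polynomial P
 (taken monomial: every homogeneous ideal has a monomial ideal with the same
 Hilbert function; the result is independent of the choice).\<close>
definition lex_ideal :: "nat \<Rightarrow> (real \<Rightarrow> real) \<Rightarrow> (nat \<Rightarrow> nat) set" where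
  "lex_ideal n P = saturation n (lexify n (SOME J. mono_ideal n J \<and> has_hilb_poly n J P))"

end

theory Submission
  imports Defs "HOL-Library.FuncSet"
begin

text \<open>Let $a_k$ be the number of $b_j$ equal to $n-1-k$. The lexicographic ideal consists of the monomials
  whose exponents of $x_0,\dots,x_{n-1}$ are lexicographically at least $a$, and the condition
  of the theorem says that $a_{n-1}=0$ or $a_1+\dots+a_{n-1}\le 2$. Let $I$ be a saturated Borel ideal
  with the same Hilbert polynomial; it suffices to show that $I$ is contained in the lexicographic ideal.
  If the exponents of some $u \in I$ first leave $a$ downwards at position $i<n-1$, then $I$ contains all
  monomials of large partial degree in $x_i,x_{i+1}$ over that prefix, so the Hilbert function of $I$
  grows too slowly, as long as $I$ also contains most of the monomials that are above $a$ before
  position $i$. If $a_{n-1}=0$, Macaulay's inequality in the first $n$ variables makes the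
  Hilbert functions agree in every degree, and comparing them in the degree of each lexicographic
  generator puts that generator into $I$. If $a_1+\dots+a_{n-1}\le 2$, the positions above $a$ are controlled by the Borel
  property alone. In all other cases one can lower $a_{n-1}$ by one and delete a different
  Borel-minimal generator.\<close>

subsection \<open>Lexicographic segments and shadows\<close>

text \<open>Conditions (i) and (ii) are one condition on $a$: the entry $a_0$ is $s$ if $c=1$ and 0
  otherwise, so $a_1+...+a_{n-1}$ is $r-s$ or $r$. The bound 2 comes from comparing degrees.
  Lowering $a_{n-1}$ by one gives a monomial of degree $a_0+...+a_{n-1}-1$. If this is at most
  $a_0+1$, Borel moves and multiplication lead from it to everything in the lowered lexicographic
  ideal. From $a_0+2$ on, a generator of degree $a_0+1$ cannot be reached from it and may be deleted
  instead. Macaulay's theorem enters twice: it shows that the lexification in the definition of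
  $L^P_n$ is an ideal at all, and that the saturated lexicographic ideal has the smallest Hilbert
  function. The case $a_{n-1}=0$ is special because there, setting $x_n=0$ gives the lexicographic
  ideal of the same $a$ in one variable less, again saturated, so the minimality applies to first
  differences. For $a_{n-1}>0$ the restriction is not saturated, and only the Borel order is left to
  work with.\<close>

lemma rank_bij:
  fixes gt :: "'a \<Rightarrow> 'a \<Rightarrow> bool"
  assumes fin: "finite S"
    and total: "\<And>x y. x \<in> S \<Longrightarrow> y \<in> S \<Longrightarrow> x \<noteq> y \<Longrightarrow> gt x y \<or> gt y x"
    and irrefl: "\<And>x. \<not> gt x x"
    and trans: "\<And>x y z. gt x y \<Longrightarrow> gt y z \<Longrightarrow> gt x z"
  shows "bij_betw (\<lambda>x. card {y \<in> S. gt y x}) S {..<card S}"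
proof -
  let ?r = "\<lambda>x. card {y \<in> S. gt y x}"
  have less: "?r x < ?r y" if "x \<in> S" "y \<in> S" "gt x y" for x y
  proof (rule psubset_card_mono)
    show "finite {z \<in> S. gt z y}" using fin by simp
    show "{z \<in> S. gt z x} \<subset> {z \<in> S. gt z y}"
      using that irrefl trans by blast
  qed
  have inj: "inj_on ?r S"
  proof (rule inj_onI, rule ccontr)
    fix x y assume "x \<in> S" "y \<in> S" "?r x = ?r y" "x \<noteq> y"
    then show False using total[of x y] less[of x y] less[of y x] by auto
  qed
  have "?r x < card S" if "x \<in> S" for x
    using that irrefl fin by (intro psubset_card_mono) auto
  then have "?r ` S \<subseteq> {..<card S}" by auto
  moreover have "card (?r ` S) = card {..<card S}"
    using inj by (simp add: card_image)
  ultimately have "?r ` S = {..<card S}"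
    by (simp add: card_subset_eq)
  then show ?thesis using inj by (simp add: bij_betw_def)
qed

lemma card_rank_less:
  fixes gt :: "'a \<Rightarrow> 'a \<Rightarrow> bool"
  assumes "finite S"
    and "\<And>x y. x \<in> S \<Longrightarrow> y \<in> S \<Longrightarrow> x \<noteq> y \<Longrightarrow> gt x y \<or> gt y x"
    and "\<And>x. \<not> gt x x"
    and "\<And>x y z. gt x y \<Longrightarrow> gt y z \<Longrightarrow> gt x z"
    and "N \<le> card S"
  shows "card {x \<in> S. card {y \<in> S. gt y x} < N} = N"
proof -
  let ?r = "\<lambda>x. card {y \<in> S. gt y x}"
  have bij: "bij_betw ?r S {..<card S}"
    by (rule rank_bij) (use assms in blast)+
  have "?r ` {x \<in> S. ?r x < N} = ?r ` S \<inter> {..<N}"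
    by auto
  also have "\<dots> = {..<card S} \<inter> {..<N}"
    using bij_betw_imp_surj_on[OF bij] by simp
  also have "\<dots> = {..<N}" using \<open>N \<le> card S\<close> by auto
  finally have "card (?r ` {x \<in> S. ?r x < N}) = N" by simp
  moreover have "inj_on ?r {x \<in> S. ?r x < N}"
    using bij_betw_imp_inj_on[OF bij] by (rule inj_on_subset) auto
  ultimately show ?thesis by (simp add: card_image)
qed

lemma lex_gt_irrefl: "\<not> lex_gt u u"
  by (simp add: lex_gt_def)

lemma lex_gt_trans:
  assumes "lex_gt u v" "lex_gt v w"
  shows "lex_gt u w"
proof -
  obtain i j where i: "\<forall>k<i. u k = v k" "v i < u i" and j: "\<forall>k<j. v k = w k" "w j < v j"
    using assms by (auto simp: lex_gt_def)
  have "\<forall>k<min i j. u k = w k" using i j by simp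
  moreover have "w (min i j) < u (min i j)"
    using i j by (cases i j rule: linorder_cases) (auto simp: min_def)
  ultimately show ?thesis unfolding lex_gt_def by blast
qed

lemma lex_gt_total:
  assumes "u \<noteq> v"
  shows "lex_gt u v \<or> lex_gt v u"
proof -
  obtain j where "u j \<noteq> v j" using assms by auto
  define i where "i = (LEAST j. u j \<noteq> v j)"
  have "u i \<noteq> v i" unfolding i_def by (rule LeastI) fact
  moreover have "\<forall>k<i. u k = v k" unfolding i_def using not_less_Least by blast
  ultimately show ?thesis unfolding lex_gt_def by (metis nat_neq_iff)
qed

text \<open>The first strict increase occurs at or before \<open>k\<close>. Allowing inequalities
  before \<open>k\<close> spares later proofs from locating the first difference.\<close>

lemma lex_gtI:
  assumes "\<And>l. l < k \<Longrightarrow> u l \<le> v l" "u k < v k"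
  shows "lex_gt v u"
proof -
  define i where "i = (LEAST l. u l < v l)"
  have "u i < v i" unfolding i_def by (rule LeastI[of _ k]) (rule assms(2))
  moreover have "i \<le> k" unfolding i_def by (rule Least_le) (rule assms(2))
  then have "v l = u l" if "l < i" for l
    using that not_less_Least[of l "\<lambda>l. u l < v l"] assms(1)[of l] unfolding i_def by simp
  ultimately show ?thesis by (auto simp: lex_gt_def)
qed

lemma finite_mons_deg [simp]: "finite (mons_deg n d)"
proof (rule finite_subset)
  show "mons_deg n d \<subseteq> {f. \<forall>x. (x \<in> {..n} \<longrightarrow> f x \<in> {..d}) \<and> (x \<notin> {..n} \<longrightarrow> f x = 0)}"
  proof
    fix u assume u: "u \<in> mons_deg n d"
    have "u x \<le> d" if "x \<le> n" for x
      using member_le_sum[of x "{..n}" u] that u by (simp add: mons_deg_def mdeg_def)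
    then show "u \<in> {f. \<forall>x. (x \<in> {..n} \<longrightarrow> f x \<in> {..d}) \<and> (x \<notin> {..n} \<longrightarrow> f x = 0)}"
      using u by (auto simp: mons_deg_def mons_def)
  qed
  show "finite {f :: nat \<Rightarrow> nat. \<forall>x. (x \<in> {..n} \<longrightarrow> f x \<in> {..d}) \<and> (x \<notin> {..n} \<longrightarrow> f x = 0)}"
    by (rule finite_set_of_finite_funs) simp_all
qed

definition segment :: "nat \<Rightarrow> nat \<Rightarrow> (nat \<Rightarrow> nat) set \<Rightarrow> bool" where
  "segment n d L \<longleftrightarrow> L \<subseteq> mons_deg n d \<and> (\<forall>u\<in>L. \<forall>v\<in>mons_deg n d. lex_gt v u \<longrightarrow> v \<in> L)"

definition seg :: "nat \<Rightarrow> nat \<Rightarrow> nat \<Rightarrow> (nat \<Rightarrow> nat) set" where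
  "seg n d N = {m \<in> mons_deg n d. card {v \<in> mons_deg n d. lex_gt v m} < N}"

lemma finite_segment: "segment n d L \<Longrightarrow> finite L"
  unfolding segment_def using finite_mons_deg finite_subset by blast

lemma segment_seg: "segment n d (seg n d N)"
proof -
  have "card {w \<in> mons_deg n d. lex_gt w v} \<le> card {w \<in> mons_deg n d. lex_gt w u}"
    if "lex_gt v u" for u v
    using that lex_gt_trans by (intro card_mono) auto
  then show ?thesis unfolding segment_def seg_def by (fastforce intro: le_less_trans)
qed

lemma card_seg:
  assumes "N \<le> card (mons_deg n d)"
  shows "card (seg n d N) = N"
  unfolding seg_def
  by (rule card_rank_less) (use assms lex_gt_total lex_gt_irrefl lex_gt_trans in auto)

text \<open>Initial segments of a total order form a chain. This turns size estimates for lex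
  segments into inclusions.\<close>

lemma segment_subset:
  assumes L: "segment n d L" and M: "segment n d M" and le: "card L \<le> card M"
  shows "L \<subseteq> M"
proof (rule ccontr)
  assume "\<not> L \<subseteq> M"
  then obtain u where u: "u \<in> L" "u \<notin> M" by blast
  have "v \<in> L" if "v \<in> M" for v
    using that u L M lex_gt_total[of u v] unfolding segment_def by (metis subsetD)
  with u have "M \<subset> L" by blast
  then have "card M < card L" using finite_segment[OF L] psubset_card_mono by blast
  with le show False by simp
qed

text \<open>For \<open>A\<close> in degree \<open>d\<close> this is the degree \<open>d + 1\<close>
  part of the ideal generated by \<open>A\<close>.\<close>

definition shad :: "nat \<Rightarrow> (nat \<Rightarrow> nat) set \<Rightarrow> (nat \<Rightarrow> nat) set" where
  "shad n A = {u(i := u i + 1) | u i. u \<in> A \<and> i \<le> n}"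

lemma shadI: "u \<in> A \<Longrightarrow> i \<le> n \<Longrightarrow> u(i := u i + 1) \<in> shad n A"
  by (auto simp: shad_def)

lemma inj_on_incr: "inj_on (\<lambda>u :: nat \<Rightarrow> nat. u(i := u i + 1)) A"
proof (rule inj_onI)
  fix u v :: "nat \<Rightarrow> nat" assume "u(i := u i + 1) = v(i := v i + 1)"
  then have "\<And>k. (u(i := u i + 1)) k = (v(i := v i + 1)) k" by simp
  then show "u = v" by (metis add_right_cancel ext fun_upd_apply)
qed

lemma mdeg_upd:
  assumes "i \<le> n"
  shows "mdeg n (u(i := x)) + u i = mdeg n u + x"
proof -
  have "mdeg n v = v i + sum v ({..n} - {i})" for v
    unfolding mdeg_def using assms by (intro sum.remove) auto
  then have "mdeg n u = u i + sum u ({..n} - {i})"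
    "mdeg n (u(i := x)) = x + sum (u(i := x)) ({..n} - {i})" by simp_all
  moreover have "sum (u(i := x)) ({..n} - {i}) = sum u ({..n} - {i})"
    by (rule sum.cong) auto
  ultimately show ?thesis by simp
qed

lemma mdeg_incr: "i \<le> n \<Longrightarrow> mdeg n (u(i := u i + 1)) = mdeg n u + 1"
  using mdeg_upd[of i n u "u i + 1"] by simp

lemma mdeg_decr: "i \<le> n \<Longrightarrow> 0 < u i \<Longrightarrow> mdeg n (u(i := u i - 1)) + 1 = mdeg n u"
  using mdeg_upd[of i n u "u i - 1"] by simp

lemma mons_upd: "u \<in> mons n \<Longrightarrow> i \<le> n \<Longrightarrow> u(i := x) \<in> mons n"
  by (auto simp: mons_def)

lemma mdeg_move:
  assumes "i < j" "j \<le> n" "0 < u j"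
  shows "mdeg n (u(i := u i + 1, j := u j - 1)) = mdeg n u"
  using mdeg_decr[of j n "u(i := u i + 1)"] mdeg_incr[of i n u] assms by simp

lemma mons_deg_incr: "u \<in> mons_deg n d \<Longrightarrow> i \<le> n \<Longrightarrow> u(i := u i + 1) \<in> mons_deg n (Suc d)"
  using mdeg_incr[of i n u] by (simp add: mons_deg_def mons_upd)

lemma mons_deg_decr:
  "u \<in> mons_deg n (Suc d) \<Longrightarrow> i \<le> n \<Longrightarrow> 0 < u i \<Longrightarrow> u(i := u i - 1) \<in> mons_deg n d"
  using mdeg_decr[of i n u] by (simp add: mons_deg_def mons_upd)

lemma mons_deg_move:
  "u \<in> mons_deg n d \<Longrightarrow> i < j \<Longrightarrow> j \<le> n \<Longrightarrow> 0 < u j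
    \<Longrightarrow> u(i := u i + 1, j := u j - 1) \<in> mons_deg n d"
  using mdeg_move[of i j n u] by (simp add: mons_deg_def mons_upd)

lemma shad_subset: "A \<subseteq> mons_deg n d \<Longrightarrow> shad n A \<subseteq> mons_deg n (Suc d)"
  unfolding shad_def using mons_deg_incr by blast

lemma shad_mono: "A \<subseteq> B \<Longrightarrow> shad n A \<subseteq> shad n B"
  unfolding shad_def by blast

lemma mons_deg_unique:
  assumes "u \<in> mons_deg n d" "v \<in> mons_deg n d" "\<forall>k<n. u k = v k"
  shows "u = v"
proof
  fix k
  have "mdeg n w = (\<Sum>i<n. w i) + w n" for w
    by (simp add: mdeg_def lessThan_Suc_atMost[symmetric])
  moreover have "(\<Sum>i<n. u i) = (\<Sum>i<n. v i)" using assms(3) by simp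
  ultimately have "u n = v n" using assms(1,2) by (simp add: mons_deg_def)
  then show "u k = v k"
    using assms by (cases k n rule: linorder_cases) (auto simp: mons_deg_def mons_def)
qed

text \<open>If \<open>v\<close> first exceeds $u x_i$ at \<open>k\<close>, one variable can be
  cancelled from \<open>v\<close> without falling below \<open>u\<close>: any variable after
  \<open>k\<close>, or $x_k$ itself if \<open>v\<close> ends there.\<close>

lemma segment_shad:
  assumes L: "segment n d L"
  shows "segment n (Suc d) (shad n L)"
  unfolding segment_def
proof (intro conjI ballI impI)
  show "shad n L \<subseteq> mons_deg n (Suc d)" using L shad_subset segment_def by blast
next
  fix w v assume "w \<in> shad n L" and v: "v \<in> mons_deg n (Suc d)" and gt: "lex_gt v w"
  then obtain u i where u: "u \<in> L" "i \<le> n" and w: "w = u(i := u i + 1)"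
    unfolding shad_def by blast
  obtain k where k: "\<forall>l<k. v l = w l" "w k < v k" using gt by (auto simp: lex_gt_def)
  have le: "u l \<le> w l" for l using w by simp
  have vn: "l \<le> n" if "0 < v l" for l
    using v that by (force simp: mons_deg_def mons_def not_less[symmetric])
  have kn: "k \<le> n" using k vn by simp
  have "\<exists>j\<le>n. 0 < v j \<and> v(j := v j - 1) \<in> L"
  proof (cases "\<exists>j>k. 0 < v j")
    case True
    then obtain j where j: "k < j" "0 < v j" by blast
    then have "j \<le> n" using vn by simp
    moreover have "lex_gt (v(j := v j - 1)) u"
    proof (rule lex_gtI[of k])
      show "\<And>l. l < k \<Longrightarrow> u l \<le> (v(j := v j - 1)) l" using k j le by simp
      show "u k < (v(j := v j - 1)) k" using k(2) j le[of k] by simp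
    qed
    ultimately show ?thesis using mons_deg_decr[OF v] j L u unfolding segment_def by blast
  next
    case False
    define v' where "v' = v(k := v k - 1)"
    have v': "v' \<in> mons_deg n d" unfolding v'_def using mons_deg_decr[OF v kn] k by simp
    have ge: "u l \<le> v' l" if "l \<le> k" for l
    proof (cases "l = k")
      case True
      then show ?thesis using k le[of k] by (simp add: v'_def)
    next
      case False
      with that have "l < k" by simp
      then show ?thesis using k le[of l] by (simp add: v'_def)
    qed
    have "v' \<in> L"
    proof (cases "\<exists>l\<le>k. u l < v' l")
      case True
      then obtain l where "l \<le> k" "u l < v' l" by blast
      then have "lex_gt v' u" using ge by (intro lex_gtI[of l]) auto
      then show ?thesis using v' L u unfolding segment_def by blast
    next
      case False
      \<comment> \<open>Without a strict increase up to \<open>k\<close>, and with \<open>v'\<close>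
        zero beyond \<open>k\<close>, \<open>v'\<close> is pointwise at most \<open>u\<close>; equal
        degrees then force \<open>v' = u\<close>.\<close>
      have "v' l \<le> u l" for l
      proof (cases "l \<le> k")
        case True
        with False show ?thesis by (meson linorder_not_le)
      next
        assume "\<not> l \<le> k"
        with \<open>\<not> (\<exists>j>k. 0 < v j)\<close> show ?thesis by (auto simp: v'_def)
      qed
      moreover have "mdeg n u = mdeg n v'" using u L v' unfolding segment_def mons_deg_def by auto
      ultimately have "v' l = u l" if "l \<le> n" for l
        using that unfolding mdeg_def
        by (metis (no_types, lifting) atMost_iff finite_atMost order_antisym_conv sum_strict_mono_ex1 linorder_not_le less_irrefl)
      then have "v' = u" using u(1) L v' unfolding segment_def
        by (intro mons_deg_unique[of v' n d]) auto
      then show ?thesis using u by simp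
    qed
    then show ?thesis using kn k by (auto simp: v'_def intro!: exI[of _ k])
  qed
  then obtain j where "j \<le> n" "0 < v j" "v(j := v j - 1) \<in> L" by blast
  then show "v \<in> shad n L" using shadI[of "v(j := v j - 1)" L j n] by simp
qed

subsection \<open>Compression\<close>

text \<open>Only the exponents of $x_i$ and $x_n$ vary, so in a fixed degree a member is determined
  by its last exponent and a fibre is in effect a set of numbers.\<close>

definition fibre :: "nat \<Rightarrow> nat \<Rightarrow> (nat \<Rightarrow> nat) set \<Rightarrow> (nat \<Rightarrow> nat) \<Rightarrow> (nat \<Rightarrow> nat) set" where
  "fibre i n A w = {v \<in> A. \<forall>k. k \<noteq> i \<and> k \<noteq> n \<longrightarrow> v k = w k}"

text \<open>Two-variable compression: a fibre with \<open>c\<close> members is replaced by the one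
  with last exponents 0 to \<open>c - 1\<close>, the lex-largest choice of that size.\<close>

definition compress :: "nat \<Rightarrow> nat \<Rightarrow> nat \<Rightarrow> (nat \<Rightarrow> nat) set \<Rightarrow> (nat \<Rightarrow> nat) set" where
  "compress i n d A = {w \<in> mons_deg n d. w n < card (fibre i n A w)}"

text \<open>The rank of \<open>v\<close> in its fibre becomes the last exponent and $x_i$ absorbs
  the difference. This bijection shows that \<open>compress\<close> preserves sizes.\<close>

definition push :: "nat \<Rightarrow> nat \<Rightarrow> (nat \<Rightarrow> nat) set \<Rightarrow> (nat \<Rightarrow> nat) \<Rightarrow> (nat \<Rightarrow> nat)" where
  "push i n A v = (let r = card {x \<in> fibre i n A v. x n < v n}
     in v(i := v i + v n - r, n := r))"

lemma fibre_cong: "(\<And>k. k \<noteq> i \<Longrightarrow> k \<noteq> n \<Longrightarrow> v k = w k) \<Longrightarrow> fibre i n A v = fibre i n A w"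
  unfolding fibre_def by auto

lemma fibre_eqI:
  assumes A: "A \<subseteq> mons_deg n d" and i: "i < n"
    and x: "x \<in> fibre i n A w" and y: "y \<in> fibre i n A w" and eq: "x n = y n"
  shows "x = y"
proof -
  have xy: "x k = y k" if "k \<noteq> i" for k
    using x y eq that by (cases "k = n") (auto simp: fibre_def)
  have "y = x(i := y i)" using xy by auto
  moreover have "mdeg n x = mdeg n y" using x y A by (auto simp: fibre_def mons_deg_def)
  ultimately have "x i = y i" using mdeg_upd[of i n x "y i"] i by simp
  with xy show ?thesis by (metis ext)
qed

lemma finite_fibre: "A \<subseteq> mons_deg n d \<Longrightarrow> finite (fibre i n A w)"
  by (rule finite_subset[of _ "mons_deg n d"]) (auto simp: fibre_def)

lemma fibre_rank_bij:
  assumes A: "A \<subseteq> mons_deg n d" and i: "i < n"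
  shows "bij_betw (\<lambda>x. card {y \<in> fibre i n A w. y n < x n}) (fibre i n A w) {..<card (fibre i n A w)}"
proof (rule rank_bij[OF finite_fibre[OF A]])
  fix x y assume "x \<in> fibre i n A w" "y \<in> fibre i n A w" "x \<noteq> y"
  then show "x n < y n \<or> y n < x n" using fibre_eqI[OF A i, of x w y] by (meson linorder_neqE_nat)
qed auto

lemma fibre_rank_le:
  assumes A: "A \<subseteq> mons_deg n d" and i: "i < n"
  shows "card {x \<in> fibre i n A v. x n < v n} \<le> v n"
proof -
  have "card {x \<in> fibre i n A v. x n < v n} = card ((\<lambda>x. x n) ` {x \<in> fibre i n A v. x n < v n})"
    using fibre_eqI[OF A i] by (intro card_image[symmetric] inj_onI) auto
  also have "\<dots> \<le> card {..<v n}" by (rule card_mono) auto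
  finally show ?thesis by simp
qed

lemma push_mons_deg:
  assumes A: "A \<subseteq> mons_deg n d" and i: "i < n" and v: "v \<in> mons_deg n d"
  shows "push i n A v \<in> mons_deg n d"
proof -
  define r where "r = card {x \<in> fibre i n A v. x n < v n}"
  have "r \<le> v n" unfolding r_def by (rule fibre_rank_le[OF A i])
  moreover have "mdeg n (v(i := v i + v n - r)) + v i = mdeg n v + (v i + v n - r)"
    using i by (intro mdeg_upd) simp
  moreover have "mdeg n ((v(i := v i + v n - r))(n := r)) + v n = mdeg n (v(i := v i + v n - r)) + r"
    using mdeg_upd[of n n "v(i := v i + v n - r)" r] i by simp
  ultimately have "mdeg n (push i n A v) = mdeg n v"
    unfolding push_def Let_def r_def[symmetric] by simp
  moreover have "push i n A v \<in> mons n"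
    using v i unfolding push_def Let_def by (intro mons_upd) (auto simp: mons_deg_def)
  ultimately show ?thesis using v by (simp add: mons_deg_def)
qed

lemma push_n: "push i n A v n = card {x \<in> fibre i n A v. x n < v n}"
  by (simp add: push_def Let_def)

lemma push_other: "k \<noteq> i \<Longrightarrow> k \<noteq> n \<Longrightarrow> push i n A v k = v k"
  by (simp add: push_def Let_def)

lemma fibre_push: "fibre i n A (push i n A v) = fibre i n A v"
  by (rule fibre_cong) (rule push_other)

lemma fibre_refl: "v \<in> A \<Longrightarrow> v \<in> fibre i n A v"
  by (simp add: fibre_def)

lemma push_bij:
  assumes A: "A \<subseteq> mons_deg n d" and i: "i < n"
  shows "bij_betw (push i n A) A (compress i n d A)"
  unfolding bij_betw_def
proof
  show "inj_on (push i n A) A"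
  proof (rule inj_onI)
    fix x y assume xy: "x \<in> A" "y \<in> A" and eq: "push i n A x = push i n A y"
    have F: "fibre i n A x = fibre i n A y" using fibre_push eq by metis
    have "x \<in> fibre i n A x" "y \<in> fibre i n A x"
      using xy fibre_refl[of _ A i n] F by auto
    moreover have "card {z \<in> fibre i n A x. z n < x n} = card {z \<in> fibre i n A x. z n < y n}"
      using fun_cong[OF eq, of n] F by (simp add: push_n)
    ultimately show "x = y"
      using bij_betw_imp_inj_on[OF fibre_rank_bij[OF A i, of x]] by (auto dest: inj_onD)
  qed
  show "push i n A ` A = compress i n d A"
  proof
    show "push i n A ` A \<subseteq> compress i n d A"
    proof
      fix w assume "w \<in> push i n A ` A"
      then obtain v where v: "v \<in> A" "w = push i n A v" by blast
      have "card {x \<in> fibre i n A v. x n < v n} \<in> {..<card (fibre i n A v)}"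
        using bij_betw_imp_surj_on[OF fibre_rank_bij[OF A i, of v]] fibre_refl[OF v(1)] by blast
      then show "w \<in> compress i n d A"
        using push_mons_deg[OF A i] v A unfolding compress_def
        by (auto simp: push_n fibre_push)
    qed
    show "compress i n d A \<subseteq> push i n A ` A"
    proof
      fix w assume "w \<in> compress i n d A"
      then have w: "w \<in> mons_deg n d" "w n < card (fibre i n A w)" by (auto simp: compress_def)
      then have "w n \<in> (\<lambda>x. card {y \<in> fibre i n A w. y n < x n}) ` fibre i n A w"
        using bij_betw_imp_surj_on[OF fibre_rank_bij[OF A i, of w]] by blast
      then obtain v where v: "v \<in> fibre i n A w" "w n = card {y \<in> fibre i n A w. y n < v n}"
        by blast
      have F: "fibre i n A v = fibre i n A w" using v by (intro fibre_cong) (auto simp: fibre_def)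
      have vA: "v \<in> A" using v by (simp add: fibre_def)
      have "w = push i n A v"
      proof (rule fibre_eqI[of "mons_deg n d" n d i _ w])
        show "w \<in> fibre i n (mons_deg n d) w" using w by (simp add: fibre_def)
        show "push i n A v \<in> fibre i n (mons_deg n d) w"
          using push_mons_deg[OF A i] vA A v push_other unfolding fibre_def by auto
        show "w n = push i n A v n" using v F by (simp add: push_n)
      qed (use i in auto)
      then show "w \<in> push i n A ` A" using vA by blast
    qed
  qed
qed

lemma card_compress:
  assumes "A \<subseteq> mons_deg n d" "i < n"
  shows "card (compress i n d A) = card A"
  using bij_betw_same_card[OF push_bij[OF assms]] by simp

text \<open>A failing exchange at \<open>u\<close> is a gap at \<open>u n - 1\<close> in its fibre,
  so the rank of \<open>u\<close> is below \<open>u n\<close>, while no rank exceeds the exponent.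
  The sum of last exponents thus measures the progress of repeated compression.\<close>

lemma compress_sum_less:
  assumes A: "A \<subseteq> mons_deg n d" and i: "i < n"
    and u: "u \<in> A" "0 < u n" "u(i := u i + 1, n := u n - 1) \<notin> A"
  shows "(\<Sum>v\<in>compress i n d A. v n) < (\<Sum>v\<in>A. v n)"
proof -
  have "(\<Sum>v\<in>compress i n d A. v n) = (\<Sum>v\<in>A. push i n A v n)"
    by (rule sum.reindex_bij_betw[OF push_bij[OF A i], symmetric])
  also have "\<dots> < (\<Sum>v\<in>A. v n)"
  proof (rule sum_strict_mono_ex1)
    show "finite A" using A finite_mons_deg finite_subset by blast
    show "\<forall>v\<in>A. push i n A v n \<le> v n"
      using fibre_rank_le[OF A i] by (simp add: push_n)
    have "x n \<noteq> u n - 1" if "x \<in> fibre i n A u" for x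
    proof
      let ?u = "u(i := u i + 1, n := u n - 1)"
      assume "x n = u n - 1"
      then have "x = ?u"
      proof (intro fibre_eqI[of "mons_deg n d" n d i x u])
        show "x \<in> fibre i n (mons_deg n d) u" using that A by (auto simp: fibre_def)
        show "?u \<in> fibre i n (mons_deg n d) u"
          using mons_deg_move[of u n d i n] u A i by (auto simp: fibre_def)
      qed (use i in auto)
      then show False using that u by (simp add: fibre_def)
    qed
    then have "(\<lambda>x. x n) ` {x \<in> fibre i n A u. x n < u n} \<subseteq> {..<u n - 1}" by fastforce
    then have "card ((\<lambda>x. x n) ` {x \<in> fibre i n A u. x n < u n}) \<le> card {..<u n - 1}"
      by (intro card_mono) auto
    moreover have "card ((\<lambda>x. x n) ` {x \<in> fibre i n A u. x n < u n}) = push i n A u n"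
      unfolding push_n using fibre_eqI[OF A i] by (intro card_image inj_onI) auto
    ultimately have "push i n A u n < u n" using u(2) unfolding card_lessThan by linarith
    then show "\<exists>v\<in>A. push i n A v n < v n" using u(1) by (rule bexI)
  qed
  finally show ?thesis .
qed

text \<open>Multiplication by a variable does not shrink a fibre. For $x_n$ one more element is
  required, and it exists because \<open>c\<close> numbers shifted by 0 and by 1 give at least
  \<open>c + 1\<close> numbers.\<close>

lemma shad_compress:
  assumes A: "A \<subseteq> mons_deg n d" and i: "i < n"
  shows "shad n (compress i n d A) \<subseteq> compress i n (Suc d) (shad n A)"
proof
  fix z assume "z \<in> shad n (compress i n d A)"
  then obtain w k where w: "w \<in> compress i n d A" "k \<le> n" and z: "z = w(k := w k + 1)"
    unfolding shad_def by blast
  have wd: "w \<in> mons_deg n d" and wn: "w n < card (fibre i n A w)"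
    using w by (auto simp: compress_def)
  let ?F = "fibre i n A w" and ?G = "fibre i n (shad n A) z"
  have finG: "finite ?G" using finite_fibre[OF shad_subset[OF A]] .
  have inj: "inj_on (\<lambda>v. v(l := v l + 1)) ?F" for l :: nat
    by (rule inj_on_incr)
  \<comment> \<open>Multiplication by $x_i$ and by $x_n$ leads to the same fibre, because fibres
    ignore both exponents.\<close>
  have sub: "(\<lambda>v. v(l := v l + 1)) ` ?F \<subseteq> ?G" if "l = k \<or> {l, k} \<subseteq> {i, n}" for l
  proof
    fix y assume "y \<in> (\<lambda>v. v(l := v l + 1)) ` ?F"
    then obtain v where v: "v \<in> ?F" "y = v(l := v l + 1)" by blast
    have "l \<le> n" using that w i by auto
    then have "y \<in> shad n A" using v shadI[of v A l n] by (simp add: fibre_def)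
    then show "y \<in> ?G" using v that z by (auto simp: fibre_def)
  qed
  have "z n < card ?G"
  proof (cases "k = n")
    case False
    have "card ((\<lambda>v. v(k := v k + 1)) ` ?F) \<le> card ?G"
      by (rule card_mono[OF finG]) (rule sub, simp)
    then show ?thesis using wn z False card_image[OF inj] by simp
  next
    case True
    have finF: "finite ?F" using finite_fibre[OF A] .
    have "?F \<noteq> {}" using wn by auto
    then have "Max ((\<lambda>y. y n) ` ?F) \<in> (\<lambda>y. y n) ` ?F" using finF by (intro Max_in) auto
    then obtain x where x: "x \<in> ?F" and "x n = Max ((\<lambda>y. y n) ` ?F)" by auto
    then have x_max: "y n \<le> x n" if "y \<in> ?F" for y using finF that by simp
    let ?x = "x(n := x n + 1)"
    let ?I = "(\<lambda>v. v(i := v i + 1)) ` ?F"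
    have "?x \<notin> ?I"
    proof
      assume "?x \<in> ?I"
      then obtain v where v: "v \<in> ?F" "?x = v(i := v i + 1)" by blast
      have "x n + 1 = v n" using i fun_cong[OF v(2), of n] by simp
      then show False using x_max[OF v(1)] by simp
    qed
    moreover have "?x \<in> ?G" using sub[of n] x True by auto
    moreover have "?I \<subseteq> ?G" using sub[of i] True by simp
    ultimately have "card (insert ?x ?I) \<le> card ?G" by (intro card_mono[OF finG]) auto
    then show ?thesis using wn z True card_image[OF inj] \<open>?x \<notin> ?I\<close> finF by simp
  qed
  then show "z \<in> compress i n (Suc d) (shad n A)"
    using mons_deg_incr[OF wd w(2)] z by (simp add: compress_def)
qed

lemma card_shad_compress_le:
  assumes A: "A \<subseteq> mons_deg n d" and i: "i < n"
  shows "card (shad n (compress i n d A)) \<le> card (shad n A)"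
proof -
  have "card (shad n (compress i n d A)) \<le> card (compress i n (Suc d) (shad n A))"
    by (rule card_mono[OF _ shad_compress[OF A i]])
      (rule finite_subset[of _ "mons_deg n (Suc d)"], auto simp: compress_def)
  then show ?thesis using card_compress[OF shad_subset[OF A] i] by simp
qed

text \<open>The part of the Borel condition that compression against $x_n$ can achieve; it is enough
  to count shadows by slices.\<close>

definition last_stable :: "nat \<Rightarrow> (nat \<Rightarrow> nat) set \<Rightarrow> bool" where
  "last_stable n A \<longleftrightarrow> (\<forall>u\<in>A. \<forall>i<n. 0 < u n \<longrightarrow> u(i := u i + 1, n := u n - 1) \<in> A)"

lemma exists_last_stable:
  assumes "A \<subseteq> mons_deg n d"
  shows "\<exists>B \<subseteq> mons_deg n d. card B = card A \<and> card (shad n B) \<le> card (shad n A) \<and> last_stable n B"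
  using assms
proof (induction "\<Sum>v\<in>A. v n" arbitrary: A rule: less_induct)
  case less
  show ?case
  proof (cases "last_stable n A")
    case True
    then show ?thesis using less.prems by blast
  next
    case False
    then obtain u i where u: "u \<in> A" "i < n" "0 < u n" "u(i := u i + 1, n := u n - 1) \<notin> A"
      by (auto simp: last_stable_def)
    have "compress i n d A \<subseteq> mons_deg n d" by (auto simp: compress_def)
    then obtain B where "B \<subseteq> mons_deg n d" "card B = card (compress i n d A)"
      "card (shad n B) \<le> card (shad n (compress i n d A))" "last_stable n B"
      using less.hyps[OF compress_sum_less[OF less.prems u(2,1,3,4)]] by blast
    then show ?thesis
      using card_compress[OF less.prems u(2)] card_shad_compress_le[OF less.prems u(2)]
      by (metis le_trans)
  qed
qed

subsection \<open>Macaulay's inequality\<close>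

definition slice :: "nat \<Rightarrow> nat \<Rightarrow> (nat \<Rightarrow> nat) set \<Rightarrow> (nat \<Rightarrow> nat) set" where
  "slice m j A = {v \<in> mons m. v(Suc m := j) \<in> A}"

lemma mons_Suc_upd: "v \<in> mons m \<Longrightarrow> v(Suc m := j) \<in> mons (Suc m)"
  by (auto simp: mons_def)

lemma mons_mono: "v \<in> mons m \<Longrightarrow> v \<in> mons (Suc m)"
  by (auto simp: mons_def)

lemma mons_last_zero: "v \<in> mons m \<Longrightarrow> v(Suc m := 0) = v"
  by (auto simp: mons_def)

lemma mons_Suc_drop: "u \<in> mons (Suc m) \<Longrightarrow> u(Suc m := 0) \<in> mons m"
  by (auto simp: mons_def)

lemma mdeg_Suc: "mdeg (Suc m) u = mdeg m u + u (Suc m)"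
  by (simp add: mdeg_def)

lemma mdeg_cong: "(\<And>k. k \<le> n \<Longrightarrow> u k = v k) \<Longrightarrow> mdeg n u = mdeg n v"
  by (simp add: mdeg_def)

lemma mdeg_upd_last: "mdeg m (u(Suc m := j)) = mdeg m u"
  by (rule mdeg_cong) simp

lemma slice_0: "slice m 0 A = A \<inter> mons m"
  using mons_last_zero by (auto simp: slice_def)

lemma slice_mons_deg:
  assumes "A \<subseteq> mons_deg (Suc m) d"
  shows "slice m j A \<subseteq> mons_deg m (d - j)"
  using assms by (auto simp: slice_def mons_deg_def mdeg_Suc mdeg_upd_last)

lemma card_slices:
  assumes A: "A \<subseteq> mons_deg (Suc m) d"
  shows "card A = (\<Sum>j\<le>d. card (slice m j A))"
proof -
  have finA: "finite A" using A finite_mons_deg finite_subset by blast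
  have "u (Suc m) \<le> d" if "u \<in> A" for u
    using that A by (auto simp: mons_deg_def mdeg_Suc)
  then have A_eq: "A = (\<Union>j\<le>d. {u \<in> A. u (Suc m) = j})" by auto
  have "card A = (\<Sum>j\<le>d. card {u \<in> A. u (Suc m) = j})"
    by (subst A_eq, rule card_UN_disjoint) (use finA in auto)
  also have "\<dots> = (\<Sum>j\<le>d. card (slice m j A))"
  proof (rule sum.cong)
    fix j
    have "bij_betw (\<lambda>v. v(Suc m := j)) (slice m j A) {u \<in> A. u (Suc m) = j}"
    proof (rule bij_betw_byWitness[where f' = "\<lambda>u. u(Suc m := 0)"])
      show "(\<lambda>u. u(Suc m := 0)) ` {u \<in> A. u (Suc m) = j} \<subseteq> slice m j A"
        using A by (auto simp: slice_def mons_deg_def mons_Suc_drop)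
    qed (auto simp: slice_def mons_last_zero)
    then show "card {u \<in> A. u (Suc m) = j} = card (slice m j A)"
      by (rule bij_betw_same_card[symmetric])
  qed simp
  finally show ?thesis .
qed

lemma shad_slice_subset:
  assumes st: "last_stable (Suc m) A"
  shows "shad m (slice m (Suc j) A) \<subseteq> slice m j A"
proof
  fix z assume "z \<in> shad m (slice m (Suc j) A)"
  then obtain v i where v: "v \<in> mons m" "v(Suc m := Suc j) \<in> A" "i \<le> m" and z: "z = v(i := v i + 1)"
    by (auto simp: shad_def slice_def)
  have "(v(Suc m := Suc j))(i := (v(Suc m := Suc j)) i + 1, Suc m := (v(Suc m := Suc j)) (Suc m) - 1) \<in> A"
    using st v unfolding last_stable_def
    by (elim ballE[of _ _ "v(Suc m := Suc j)"] allE[of _ i]) auto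
  moreover have "(v(Suc m := Suc j))(i := (v(Suc m := Suc j)) i + 1, Suc m := (v(Suc m := Suc j)) (Suc m) - 1)
      = z(Suc m := j)" using v z by auto
  ultimately show "z \<in> slice m j A" using v z by (simp add: slice_def mons_upd)
qed

text \<open>If $x_{m+1}$ divides \<open>u\<close>, stability rewrites $u x_i$ as $x_{m+1}$ times
  another element of \<open>A\<close>. Only products from slice 0 are new, and they live in one
  variable less.\<close>

lemma card_shad_stable:
  assumes A: "A \<subseteq> mons_deg (Suc m) d" and st: "last_stable (Suc m) A"
  shows "card (shad (Suc m) A) = card A + card (shad m (slice m 0 A))"
proof -
  let ?f = "\<lambda>u :: nat \<Rightarrow> nat. u(Suc m := u (Suc m) + 1)"
  have inj: "inj_on ?f A"
    by (rule inj_on_incr)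
  have "shad (Suc m) A = ?f ` A \<union> shad m (slice m 0 A)"
  proof
    show "shad (Suc m) A \<subseteq> ?f ` A \<union> shad m (slice m 0 A)"
    proof
      fix z assume "z \<in> shad (Suc m) A"
      then obtain u i where u: "u \<in> A" "i \<le> Suc m" and z: "z = u(i := u i + 1)"
        by (auto simp: shad_def)
      consider "i = Suc m" | "i \<le> m" "0 < u (Suc m)" | "i \<le> m" "u (Suc m) = 0"
        using u by linarith
      then show "z \<in> ?f ` A \<union> shad m (slice m 0 A)"
      proof cases
        case 1
        then show ?thesis using u z by auto
      next
        case 2
        let ?w = "u(i := u i + 1, Suc m := u (Suc m) - 1)"
        have "?w \<in> A" using st u 2 unfolding last_stable_def by auto
        moreover have "z = ?f ?w" using z 2 by auto
        ultimately show ?thesis by blast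
      next
        case 3
        have "u(Suc m := 0) = u" using 3 by auto
        moreover have "u \<in> mons (Suc m)" using u A by (auto simp: mons_deg_def)
        ultimately have "u \<in> mons m" using mons_Suc_drop[of u m] by simp
        then have "u \<in> slice m 0 A" using u by (simp add: slice_0)
        then show ?thesis using z 3 shadI by blast
      qed
    qed
    show "?f ` A \<union> shad m (slice m 0 A) \<subseteq> shad (Suc m) A"
    proof (intro Un_least subsetI)
      fix z assume "z \<in> ?f ` A"
      then show "z \<in> shad (Suc m) A" using shadI[of _ A "Suc m" "Suc m"] by blast
    next
      fix z assume "z \<in> shad m (slice m 0 A)"
      then obtain u i where "u \<in> A" "i \<le> m" "z = u(i := u i + 1)"
        unfolding shad_def slice_0 by blast
      then show "z \<in> shad (Suc m) A" using shadI[of u A i "Suc m"] by simp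
    qed
  qed
  moreover have "?f ` A \<inter> shad m (slice m 0 A) = {}"
  proof -
    have "z (Suc m) = 0" if "z \<in> shad m (slice m 0 A)" for z
    proof -
      obtain u i where "u \<in> mons m" "i \<le> m" "z = u(i := u i + 1)"
        using \<open>z \<in> shad m (slice m 0 A)\<close> unfolding shad_def slice_0 by blast
      then show ?thesis by (simp add: mons_def)
    qed
    then show ?thesis by fastforce
  qed
  moreover have "finite (?f ` A)" "finite (shad m (slice m 0 A))"
    using finite_subset[OF A] finite_subset[OF shad_subset[OF slice_mons_deg[OF A]]] by auto
  ultimately show ?thesis using card_Un_disjoint card_image[OF inj] by metis
qed

lemma lex_gt_upd_same:
  assumes "v \<in> mons m" "w \<in> mons m" "lex_gt v w"
  shows "lex_gt (v(Suc m := j)) (w(Suc m := k))"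
proof -
  obtain i where i: "\<forall>k<i. v k = w k" "w i < v i" using assms by (auto simp: lex_gt_def)
  then have "i \<le> m" using assms by (auto simp: mons_def not_less[symmetric])
  then show ?thesis using i by (intro lex_gtI[of i]) auto
qed

lemma segment_slice:
  assumes "segment (Suc m) d L" "j \<le> d"
  shows "segment m (d - j) (slice m j L)"
  unfolding segment_def
proof (intro conjI ballI impI)
  show "slice m j L \<subseteq> mons_deg m (d - j)" using assms slice_mons_deg by (simp add: segment_def)
next
  fix u v assume "u \<in> slice m j L" "v \<in> mons_deg m (d - j)" "lex_gt v u"
  moreover from this have "v(Suc m := j) \<in> mons_deg (Suc m) d"
    using assms(2) by (simp add: mons_deg_def mdeg_Suc mdeg_upd_last mons_Suc_upd)
  ultimately show "v \<in> slice m j L"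
    using assms(1) lex_gt_upd_same unfolding segment_def slice_def mons_deg_def by blast
qed

lemma segment_last_stable:
  assumes "segment n d L"
  shows "last_stable n L"
  unfolding last_stable_def
proof (intro ballI allI impI)
  fix u i assume u: "u \<in> L" "i < n" "0 < u n"
  let ?w = "u(i := u i + 1, n := u n - 1)"
  have "lex_gt ?w u" using u by (intro lex_gtI[of i]) auto
  moreover have "?w \<in> mons_deg n d" using u assms mons_deg_move unfolding segment_def by blast
  ultimately show "?w \<in> L" using u assms unfolding segment_def by blast
qed

lemma last_stable_collect:
  assumes "last_stable (Suc m) A" "u \<in> A"
  shows "u(m := u m + u (Suc m), Suc m := 0) \<in> A"
  using assms(2)
proof (induction "u (Suc m)" arbitrary: u)
  case 0
  then have "u(m := u m + u (Suc m), Suc m := 0) = u" by auto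
  then show ?case using 0 by simp
next
  case (Suc k)
  let ?w = "u(m := u m + 1, Suc m := u (Suc m) - 1)"
  have "?w \<in> A" using assms(1) Suc unfolding last_stable_def by auto
  moreover have "k = ?w (Suc m)" using Suc.hyps(2) by simp
  ultimately have "?w(m := ?w m + ?w (Suc m), Suc m := 0) \<in> A" using Suc.hyps(1) by blast
  moreover have "?w(m := ?w m + ?w (Suc m), Suc m := 0) = u(m := u m + u (Suc m), Suc m := 0)"
    using Suc.hyps(2) by auto
  ultimately show ?case by simp
qed

text \<open>Every slice becomes a lex segment of unchanged size; Macaulay's inequality in fewer
  variables will keep the result \<open>last_stable\<close>.\<close>

definition compress_last :: "nat \<Rightarrow> nat \<Rightarrow> (nat \<Rightarrow> nat) set \<Rightarrow> (nat \<Rightarrow> nat) set" where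
  "compress_last m d A = {u \<in> mons_deg (Suc m) d.
     u(Suc m := 0) \<in> seg m (d - u (Suc m)) (card (slice m (u (Suc m)) A))}"

lemma slice_compress_last:
  assumes "A \<subseteq> mons_deg (Suc m) d" "j \<le> d"
  shows "slice m j (compress_last m d A) = seg m (d - j) (card (slice m j A))"
proof -
  have up: "v(Suc m := j) \<in> mons_deg (Suc m) d" if "v \<in> mons_deg m (d - j)" for v
    using that assms(2) by (simp add: mons_deg_def mdeg_Suc mdeg_upd_last mons_Suc_upd)
  have sub: "v \<in> mons_deg m (d - j)" if "v \<in> seg m (d - j) N" for v N
    using that by (simp add: seg_def)
  have "v \<in> slice m j (compress_last m d A) \<longleftrightarrow> v \<in> seg m (d - j) (card (slice m j A))" for v
  proof (cases "v \<in> mons m")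
    case True
    then show ?thesis
      using up[of v] sub[of v] mons_last_zero[OF True]
      by (subst slice_def) (auto simp: compress_last_def)
  next
    case False
    then show ?thesis using sub[of v] by (subst slice_def) (auto simp: mons_deg_def)
  qed
  then show ?thesis by blast
qed

lemma card_slice_le:
  assumes "A \<subseteq> mons_deg (Suc m) d"
  shows "card (slice m j A) \<le> card (mons_deg m (d - j))"
  using slice_mons_deg[OF assms] by (simp add: card_mono)

lemma card_compress_last:
  assumes A: "A \<subseteq> mons_deg (Suc m) d"
  shows "card (compress_last m d A) = card A"
proof -
  have "compress_last m d A \<subseteq> mons_deg (Suc m) d" by (auto simp: compress_last_def)
  then have "card (compress_last m d A) = (\<Sum>j\<le>d. card (slice m j (compress_last m d A)))"
    by (rule card_slices)
  also have "\<dots> = (\<Sum>j\<le>d. card (slice m j A))"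
    by (rule sum.cong) (simp_all add: slice_compress_last[OF A] card_seg[OF card_slice_le[OF A]])
  finally show ?thesis using card_slices[OF A] by simp
qed

text \<open>Induction on the number of variables. By \<open>card_shad_stable\<close> both shadows
  split into the size of the set and the shadow of slice 0, so it remains to compare the sizes of
  the two slices 0.\<close>

theorem macaulay_shadow:
  assumes "A \<subseteq> mons_deg n d" "segment n d L" "card L \<le> card A"
  shows "card (shad n L) \<le> card (shad n A)"
  using assms
proof (induction n arbitrary: d A L)
  case 0
  have "A \<subseteq> mons_deg 0 d" "L \<subseteq> mons_deg 0 d" using 0 by (auto simp: segment_def)
  moreover have "u = v" if "u \<in> mons_deg 0 d" "v \<in> mons_deg 0 d" for u v
    using that by (intro mons_deg_unique) auto
  moreover have "L = {}" if "A = {}" using that 0 finite_segment by fastforce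
  ultimately have "L \<subseteq> A" by (metis all_not_in_conv subsetD subsetI)
  then have "shad 0 L \<subseteq> shad 0 A" by (rule shad_mono)
  then show ?case using finite_subset[OF shad_subset[OF 0(1)]] by (simp add: card_mono)
next
  case (Suc m)
  obtain B where B: "B \<subseteq> mons_deg (Suc m) d" "card B = card A"
    "card (shad (Suc m) B) \<le> card (shad (Suc m) A)" and st: "last_stable (Suc m) B"
    using exists_last_stable[OF Suc.prems(1)] by blast
  let ?C = "compress_last m d B"
  have stC: "last_stable (Suc m) ?C"
    unfolding last_stable_def
  proof (intro ballI allI impI)
    fix u i assume u: "u \<in> ?C" "i < Suc m" "0 < u (Suc m)"
    obtain j where j: "u (Suc m) = Suc j" using u by (cases "u (Suc m)") auto
    have jd: "Suc j \<le> d" using u j by (auto simp: compress_last_def mons_deg_def mdeg_Suc)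
    have sj: "u(Suc m := 0) \<in> seg m (d - Suc j) (card (slice m (Suc j) B))"
      using u j by (simp add: compress_last_def)
    \<comment> \<open>Stability of \<open>?C\<close> means that the shadow of slice
      \<open>j + 1\<close> lies in slice \<open>j\<close>. Both are segments, so their sizes
      decide.\<close>
    have "shad m (seg m (d - Suc j) (card (slice m (Suc j) B))) \<subseteq> seg m (d - j) (card (slice m j B))"
    proof (rule segment_subset[where n = m and d = "d - j"])
      show "segment m (d - j) (shad m (seg m (d - Suc j) (card (slice m (Suc j) B))))"
        using segment_shad[OF segment_seg] jd by (metis Suc_diff_Suc Suc_le_lessD)
      have "card (shad m (seg m (d - Suc j) (card (slice m (Suc j) B)))) \<le> card (shad m (slice m (Suc j) B))"
        using Suc.IH[OF slice_mons_deg[OF B(1)] segment_seg] card_seg[OF card_slice_le[OF B(1)]] by simp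
      also have "\<dots> \<le> card (slice m j B)"
        using shad_slice_subset[OF st] finite_subset[OF slice_mons_deg[OF B(1)] finite_mons_deg]
        by (simp add: card_mono)
      finally show "card (shad m (seg m (d - Suc j) (card (slice m (Suc j) B)))) \<le> card (seg m (d - j) (card (slice m j B)))"
        using card_seg[OF card_slice_le[OF B(1)]] by simp
    qed (rule segment_seg)
    then have "(u(Suc m := 0))(i := (u(Suc m := 0)) i + 1) \<in> seg m (d - j) (card (slice m j B))"
      using shadI[OF sj, of i m] u by auto
    moreover have "(u(i := u i + 1, Suc m := u (Suc m) - 1))(Suc m := 0) = (u(Suc m := 0))(i := (u(Suc m := 0)) i + 1)"
      using u by auto
    moreover have "u(i := u i + 1, Suc m := u (Suc m) - 1) \<in> mons_deg (Suc m) d"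
      using mons_deg_move[of u "Suc m" d i "Suc m"] u by (simp add: compress_last_def)
    ultimately show "u(i := u i + 1, Suc m := u (Suc m) - 1) \<in> ?C"
      using j unfolding compress_last_def by simp
  qed
  have C0: "slice m 0 ?C = seg m d (card (slice m 0 B))" using slice_compress_last[OF B(1), of 0] by simp
  \<comment> \<open>Otherwise some \<open>u\<close> in slice 0 of \<open>L\<close> lies beyond the
    segment \<open>slice m 0 ?C\<close>. All of \<open>?C\<close> is then lex-larger than
    \<open>u\<close>, so \<open>?C\<close> is a proper subset of \<open>L\<close>, although
    \<open>L\<close> has at most as many elements.\<close>
  have "card (slice m 0 L) \<le> card (slice m 0 B)"
  proof (rule ccontr)
    assume "\<not> ?thesis"
    then have "\<not> slice m 0 L \<subseteq> slice m 0 ?C"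
      using card_seg[OF card_slice_le[OF B(1), of 0]] C0 card_mono[of "slice m 0 ?C" "slice m 0 L"]
        finite_segment[OF segment_seg, of m d "card (slice m 0 B)"] by auto
    then obtain u where u: "u \<in> slice m 0 L" "u \<notin> slice m 0 ?C" by blast
    have "slice m 0 L \<subseteq> mons_deg m d"
      using segment_slice[OF Suc.prems(2), of 0] by (simp add: segment_def)
    then have um: "u \<in> mons_deg m d" "u \<in> L"
      using u(1) by (blast, simp add: slice_0)
    have gt: "lex_gt w u" if w: "w \<in> ?C" for w
    proof -
      \<comment> \<open>Moving all of $x_{m+1}$ into $x_m$ brings \<open>w\<close> into slice 0 and
        leaves the exponents before \<open>m\<close> unchanged.\<close>
      let ?w = "w(m := w m + w (Suc m), Suc m := 0)"
      have "?w \<in> ?C" using last_stable_collect[OF stC w] .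
      moreover have "?w \<in> mons m"
        using w mons_Suc_drop[of "w(m := w m + w (Suc m))" m]
        by (simp add: compress_last_def mons_deg_def mons_upd)
      ultimately have w0: "?w \<in> slice m 0 ?C" by (simp add: slice_0)
      then have wm: "?w \<in> mons_deg m d" using C0 by (simp add: seg_def)
      have "\<not> lex_gt u ?w" using u w0 um(1) segment_seg C0 unfolding segment_def by metis
      moreover have "u \<noteq> ?w" using u w0 by auto
      ultimately have "lex_gt ?w u" using lex_gt_total by blast
      then obtain i where i: "\<forall>k<i. ?w k = u k" "u i < ?w i" by (auto simp: lex_gt_def)
      have "i \<le> m" using i wm by (auto simp: mons_deg_def mons_def not_less[symmetric])
      \<comment> \<open>Monomials of equal degree in $x_0,...,x_m$ cannot first differ at
        \<open>m\<close>; so the difference occurs where \<open>w\<close> and \<open>?w\<close>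
        agree.\<close>
      moreover have "i \<noteq> m"
      proof
        assume "i = m"
        then have "?w = u" using i wm um by (intro mons_deg_unique[of ?w m d]) auto
        then show False using i by simp
      qed
      ultimately show "lex_gt w u" using i by (intro lex_gtI[of i]) (auto split: if_splits)
    qed
    have "?C \<subseteq> L"
    proof
      fix w assume "w \<in> ?C"
      then show "w \<in> L" using gt um Suc.prems(2) unfolding segment_def compress_last_def by blast
    qed
    moreover have "u \<notin> ?C" using gt lex_gt_irrefl by blast
    ultimately have "?C \<subset> L" using um by blast
    then have "card ?C < card L" using finite_segment[OF Suc.prems(2)] by (simp add: psubset_card_mono)
    then show False using Suc.prems card_compress_last[OF B(1)] B by simp
  qed
  then have "card (shad m (slice m 0 L)) \<le> card (shad m (slice m 0 B))"
    using Suc.IH[of "slice m 0 B" d "slice m 0 L"] slice_mons_deg[OF B(1), of 0]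
      segment_slice[OF Suc.prems(2), of 0] by simp
  moreover have "card (shad (Suc m) L) = card L + card (shad m (slice m 0 L))"
    using card_shad_stable[of L m d] segment_last_stable[OF Suc.prems(2)] Suc.prems(2)
    by (simp add: segment_def)
  ultimately show ?case
    using card_shad_stable[OF B(1) st] B Suc.prems by simp
qed

subsection \<open>Saturated lexicographic ideals\<close>

lemma mdeg_add: "mdeg n (\<lambda>i. u i + v i) = mdeg n u + mdeg n v"
  by (simp add: mdeg_def sum.distrib)

lemma mons_add: "u \<in> mons n \<Longrightarrow> v \<in> mons n \<Longrightarrow> (\<lambda>i. u i + v i) \<in> mons n"
  by (simp add: mons_def)

lemma mono_idealI:
  assumes sub: "I \<subseteq> mons n" and step: "\<And>u i. u \<in> I \<Longrightarrow> i \<le> n \<Longrightarrow> u(i := u i + 1) \<in> I"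
  shows "mono_ideal n I"
proof -
  have "(\<lambda>i. u i + v i) \<in> I" if "u \<in> I" "v \<in> mons n" for u v
    using that
  proof (induction "mdeg n v" arbitrary: u v)
    case 0
    then have "v i = 0" for i by (cases "i \<le> n") (auto simp: mdeg_def mons_def)
    then show ?case using 0 by simp
  next
    case (Suc d)
    have "\<exists>i\<le>n. 0 < v i"
    proof (rule ccontr)
      assume "\<not> ?thesis"
      then have "mdeg n v = 0" by (simp add: mdeg_def)
      with Suc.hyps(2) show False by simp
    qed
    then obtain i where i: "i \<le> n" "0 < v i" by blast
    have "d = mdeg n (v(i := v i - 1))" using mdeg_decr[of i n v] i Suc.hyps(2) by simp
    then have "(\<lambda>k. (u(i := u i + 1)) k + (v(i := v i - 1)) k) \<in> I"
      by (rule Suc.hyps(1)[OF _ step[OF Suc.prems(1) i(1)] mons_upd[OF Suc.prems(2) i(1)]])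
    moreover have "(\<lambda>k. (u(i := u i + 1)) k + (v(i := v i - 1)) k) = (\<lambda>k. u k + v k)"
      using i by auto
    ultimately show ?case by simp
  qed
  then show ?thesis using sub unfolding mono_ideal_def by blast
qed

lemma mono_idealD: "mono_ideal n I \<Longrightarrow> u \<in> I \<Longrightarrow> v \<in> mons n \<Longrightarrow> (\<lambda>i. u i + v i) \<in> I"
  by (simp add: mono_ideal_def)

lemma mono_ideal_incr:
  assumes "mono_ideal n I" "u \<in> I" "i \<le> n"
  shows "u(i := u i + 1) \<in> I"
proof -
  have "(\<lambda>k. if k = i then 1 else 0) \<in> mons n" using assms(3) by (simp add: mons_def)
  then have "(\<lambda>k. u k + (if k = i then 1 else 0)) \<in> I"
    by (rule mono_idealD[OF assms(1,2)])
  moreover have "(\<lambda>k. u k + (if k = i then 1 else 0)) = u(i := u i + 1)" by auto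
  ultimately show ?thesis by simp
qed

lemma mono_ideal_dvd:
  assumes I: "mono_ideal n I" and "u \<in> I" "v \<in> mons n" "\<And>k. k \<le> n \<Longrightarrow> u k \<le> v k"
  shows "v \<in> I"
proof -
  have "(\<lambda>k. v k - u k) \<in> mons n" using assms(3) by (simp add: mons_def)
  then have "(\<lambda>k. u k + (v k - u k)) \<in> I" by (rule mono_idealD[OF I \<open>u \<in> I\<close>])
  moreover have "(\<lambda>k. u k + (v k - u k)) = v"
  proof
    fix k
    show "u k + (v k - u k) = v k"
      using assms I by (cases "k \<le> n") (auto simp: mono_ideal_def mons_def subset_iff)
  qed
  ultimately show ?thesis by simp
qed

lemma mono_ideal_upd_last:
  assumes "mono_ideal n I" "u \<in> I" "u n \<le> x"
  shows "u(n := x) \<in> I"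
proof (rule mono_ideal_dvd[OF assms(1,2)])
  show "u(n := x) \<in> mons n" using assms by (auto simp: mono_ideal_def mons_upd)
qed (use assms in auto)

section \<open>Lexification of a monomial ideal\<close>

lemma mem_lexify:
  "u \<in> lexify n J \<longleftrightarrow> u \<in> seg n (mdeg n u) (card (mons_deg n (mdeg n u) \<inter> J))"
  unfolding lexify_def seg_def by (auto simp: mons_deg_def)

lemma lexify_deg: "lexify n J \<inter> mons_deg n d = seg n d (card (mons_deg n d \<inter> J))"
  using mem_lexify[of _ n J] by (auto simp: mons_deg_def seg_def)

lemma card_lexify_deg: "card (lexify n J \<inter> mons_deg n d) = card (mons_deg n d \<inter> J)"
  unfolding lexify_deg by (rule card_seg) (simp add: card_mono)

lemma segment_lexify: "segment n d (lexify n J \<inter> mons_deg n d)"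
  unfolding lexify_deg by (rule segment_seg)

text \<open>The shadow of the degree \<open>d\<close> segment is at most as large as that of $J_d$,
  hence at most as large as $J_{d+1}$; between segments this is inclusion.\<close>

lemma mono_ideal_lexify:
  assumes J: "mono_ideal n J"
  shows "mono_ideal n (lexify n J)"
proof (rule mono_idealI)
  show "lexify n J \<subseteq> mons n" by (auto simp: lexify_def mons_deg_def)
next
  fix u i assume u: "u \<in> lexify n J" and i: "i \<le> n"
  define d where "d = mdeg n u"
  let ?L = "\<lambda>d. lexify n J \<inter> mons_deg n d"
  have uL: "u \<in> ?L d" using u mem_lexify[of u n J] unfolding d_def seg_def by auto
  have "shad n (mons_deg n d \<inter> J) \<subseteq> mons_deg n (Suc d) \<inter> J"
    using mono_ideal_incr[OF J] mons_deg_incr unfolding shad_def by blast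
  then have "card (shad n (mons_deg n d \<inter> J)) \<le> card (mons_deg n (Suc d) \<inter> J)"
    by (simp add: card_mono)
  moreover have "card (shad n (?L d)) \<le> card (shad n (mons_deg n d \<inter> J))"
    by (rule macaulay_shadow[OF _ segment_lexify]) (simp_all add: card_lexify_deg)
  ultimately have "card (shad n (?L d)) \<le> card (?L (Suc d))" by (simp add: card_lexify_deg)
  then have "shad n (?L d) \<subseteq> ?L (Suc d)"
    by (rule segment_subset[OF segment_shad[OF segment_lexify] segment_lexify])
  then show "u(i := u i + 1) \<in> lexify n J" using shadI[OF uL i] by blast
qed

section \<open>Ideals cut out by a lexicographic threshold\<close>

definition below :: "nat \<Rightarrow> (nat \<Rightarrow> nat) \<Rightarrow> (nat \<Rightarrow> nat) \<Rightarrow> bool" where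
  "below n a u \<longleftrightarrow> (\<exists>i<n. (\<forall>k<i. u k = a k) \<and> u i < a i)"

text \<open>\<open>below n a\<close> never looks at position \<open>n\<close>, so membership does
  not depend on the exponent of $x_n$; this makes the ideal saturated.\<close>

definition lexsat :: "nat \<Rightarrow> (nat \<Rightarrow> nat) \<Rightarrow> (nat \<Rightarrow> nat) set" where
  "lexsat n a = {u \<in> mons n. \<not> below n a u}"

lemma belowI:
  assumes "i < n" "\<And>k. k < i \<Longrightarrow> u k \<le> a k" "u i < a i"
  shows "below n a u"
proof -
  define j where "j = (LEAST j. u j < a j)"
  have "u j < a j" unfolding j_def by (rule LeastI) (rule assms(3))
  moreover have ji: "j \<le> i" unfolding j_def by (rule Least_le) (rule assms(3))
  then have "u k = a k" if "k < j" for k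
    using that not_less_Least[of k "\<lambda>j. u j < a j"] assms(2)[of k] unfolding j_def by simp
  ultimately show ?thesis using assms(1) ji unfolding below_def by (intro exI[of _ j]) auto
qed

lemma below_cong: "(\<And>k. k < n \<Longrightarrow> u k = v k) \<Longrightarrow> below n a u \<longleftrightarrow> below n a v"
  unfolding below_def by (metis less_trans)

lemma below_mono: "below m a u \<Longrightarrow> m \<le> n \<Longrightarrow> below n a u"
  unfolding below_def by (meson less_le_trans)

lemma below_Suc: "below (Suc m) a u \<longleftrightarrow> below m a u \<or> (\<forall>k<m. u k = a k) \<and> u m < a m"
  unfolding below_def by (auto simp: less_Suc_eq)

lemma lexsat_mono_ideal: "mono_ideal n (lexsat n a)"
proof (rule mono_idealI)
  fix u i assume "u \<in> lexsat n a" "i \<le> n"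
  moreover have "below n a u" if b: "below n a (u(i := u i + 1))"
  proof -
    obtain j where j: "j < n" "\<forall>k<j. (u(i := u i + 1)) k = a k" "(u(i := u i + 1)) j < a j"
      using b unfolding below_def by blast
    have le: "u k \<le> (u(i := u i + 1)) k" for k by simp
    show ?thesis
    proof (rule belowI[OF j(1)])
      show "u k \<le> a k" if "k < j" for k using j(2) le[of k] that by metis
      show "u j < a j" using j(3) le[of j] by (rule le_less_trans[rotated])
    qed
  qed
  ultimately show "u(i := u i + 1) \<in> lexsat n a" by (auto simp: lexsat_def mons_upd)
qed (auto simp: lexsat_def)

lemma lexsat_borel: "borel n (lexsat n a)"
  unfolding borel_def
proof (intro ballI allI impI, elim conjE)
  fix u i j assume u: "u \<in> lexsat n a" and ij: "i < j" "j \<le> n" "0 < u j"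
  let ?w = "u(i := u i + 1, j := u j - 1)"
  have "below n a u" if b: "below n a ?w"
  proof -
    obtain k where k: "k < n" "\<forall>l<k. ?w l = a l" "?w k < a k" using b unfolding below_def by blast
    show ?thesis
    proof (cases "k \<le> i")
      case True
      have "u l \<le> a l" if "l < k" for l using k(2)[rule_format, OF that] that True ij by simp
      moreover have "u k < a k" using k(3) True ij by (auto split: if_splits)
      ultimately show ?thesis using k(1) by (intro belowI[of k])
    next
      case False
      have "u l \<le> a l" if "l < i" for l using k(2)[rule_format, of l] that False ij by simp
      moreover have "u i < a i" using k(2)[rule_format, of i] False ij by simp
      ultimately show ?thesis using k(1) False by (intro belowI[of i]) auto
    qed
  qed
  then show "?w \<in> lexsat n a" using u ij by (auto simp: lexsat_def mons_upd)
qed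

lemma lexsat_upd_last:
  assumes "u \<in> mons n"
  shows "u(n := x) \<in> lexsat n a \<longleftrightarrow> u \<in> lexsat n a"
  using assms below_cong[of n "u(n := x)" u a] by (auto simp: lexsat_def mons_upd)

lemma add_last_power:
  fixes u :: "nat \<Rightarrow> nat"
  shows "(\<lambda>i. u i + (if i = n then k else 0)) = u(n := u n + k)"
  by (simp add: fun_eq_iff)

lemma last_power_mons_deg: "(\<lambda>i. if i = n then k else 0) \<in> mons_deg n k"
  by (simp add: mons_deg_def mons_def mdeg_def)

lemma saturation_upd_last:
  assumes "u \<in> saturation n I"
  shows "\<exists>k. u(n := u n + k) \<in> I"
proof -
  obtain k where "\<forall>w\<in>mons_deg n k. (\<lambda>i. u i + w i) \<in> I" using assms by (auto simp: saturation_def)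
  then have "(\<lambda>i. u i + (if i = n then k else 0)) \<in> I" using last_power_mons_deg by (rule bspec)
  then show ?thesis unfolding add_last_power by blast
qed

lemma saturatedI:
  assumes I: "mono_ideal n I" and free: "\<And>u x. u \<in> mons n \<Longrightarrow> u(n := x) \<in> I \<Longrightarrow> u \<in> I"
  shows "saturated n I"
  unfolding saturated_def
proof (intro subset_antisym subsetI)
  fix u assume u: "u \<in> saturation n I"
  then obtain k where "u(n := u n + k) \<in> I" using saturation_upd_last by blast
  then show "u \<in> I" using u free[of u "u n + k"] by (simp add: saturation_def)
next
  fix u assume u: "u \<in> I"
  then have "(\<lambda>i. u i + w i) \<in> I" if "w \<in> mons_deg n 0" for w
    using mono_idealD[OF I] that by (simp add: mons_deg_def)
  then show "u \<in> saturation n I" using u I by (auto simp: saturation_def mono_ideal_def)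
qed

lemma lexsat_saturated: "saturated n (lexsat n a)"
  using lexsat_mono_ideal by (rule saturatedI) (simp add: lexsat_upd_last)

lemma lexsat_segment: "segment n d (lexsat n a \<inter> mons_deg n d)"
proof -
  have "below n a u" if gt: "lex_gt v u" and b: "below n a v" for u v
  proof -
    obtain i where i: "i < n" "\<forall>k<i. v k = a k" "v i < a i" using b by (auto simp: below_def)
    obtain j where j: "\<forall>k<j. v k = u k" "u j < v j" using gt by (auto simp: lex_gt_def)
    show ?thesis
      using i j by (intro belowI[of "min i j"]; cases i j rule: linorder_cases) (auto simp: min_def)
  qed
  then show ?thesis unfolding segment_def lexsat_def mons_deg_def by blast
qed

lemma hilb_fun_add_card:
  "hilb_fun n I d + card (mons_deg n d \<inter> I) = card (mons_deg n d)"
  unfolding hilb_fun_def using card_Int_Diff[of "mons_deg n d" I] by simp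

lemma lexify_eq_lexsat_deg:
  assumes "hilb_fun n J d = hilb_fun n (lexsat n a) d"
  shows "lexify n J \<inter> mons_deg n d = lexsat n a \<inter> mons_deg n d"
proof -
  have "card (lexify n J \<inter> mons_deg n d) = card (lexsat n a \<inter> mons_deg n d)"
    using assms hilb_fun_add_card[of n J d] hilb_fun_add_card[of n "lexsat n a" d]
    by (simp add: card_lexify_deg Int_commute)
  then show ?thesis
    using segment_subset[OF segment_lexify lexsat_segment] segment_subset[OF lexsat_segment segment_lexify]
    by (metis order_refl subset_antisym)
qed

text \<open>A high power of $x_n$ leads to a degree where both ideals are segments of equal size,
  and \<open>lexsat\<close> does not notice that power.\<close>

lemma lexify_subset_lexsat:
  assumes J: "mono_ideal n J"
    and ev: "\<forall>\<^sub>F d in sequentially. hilb_fun n J d = hilb_fun n (lexsat n a) d"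
    and u: "u(n := u n + k) \<in> lexify n J" "u \<in> mons n"
  shows "u \<in> lexsat n a"
proof -
  obtain N where N: "\<And>d. d \<ge> N \<Longrightarrow> hilb_fun n J d = hilb_fun n (lexsat n a) d"
    using ev by (auto simp: eventually_sequentially)
  let ?v = "u(n := u n + k + N)"
  have "?v \<in> lexify n J"
    using mono_ideal_upd_last[OF mono_ideal_lexify[OF J] u(1), of "u n + k + N"] by simp
  moreover have "mdeg n ?v \<ge> N" unfolding mdeg_def using member_le_sum[of n "{..n}" ?v] by simp
  moreover have "?v \<in> mons_deg n (mdeg n ?v)" using u by (simp add: mons_deg_def mons_upd)
  ultimately have "?v \<in> lexsat n a" using lexify_eq_lexsat_deg[OF N, of "mdeg n ?v"] by blast
  then show ?thesis using lexsat_upd_last[OF u(2)] by simp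
qed

text \<open>Makes the arbitrary choice of \<open>J\<close> in \<open>lex_ideal\<close> harmless:
  only its eventual Hilbert function matters.\<close>

lemma saturation_lexify:
  assumes J: "mono_ideal n J"
    and ev: "\<forall>\<^sub>F d in sequentially. hilb_fun n J d = hilb_fun n (lexsat n a) d"
  shows "saturation n (lexify n J) = lexsat n a"
proof
  show "saturation n (lexify n J) \<subseteq> lexsat n a"
  proof
    fix u assume u: "u \<in> saturation n (lexify n J)"
    then obtain k where "u(n := u n + k) \<in> lexify n J" using saturation_upd_last by blast
    then show "u \<in> lexsat n a" using lexify_subset_lexsat[OF J ev] u by (simp add: saturation_def)
  qed
  obtain N where N: "\<And>d. d \<ge> N \<Longrightarrow> hilb_fun n J d = hilb_fun n (lexsat n a) d"
    using ev by (auto simp: eventually_sequentially)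
  show "lexsat n a \<subseteq> saturation n (lexify n J)"
  proof
    fix u assume u: "u \<in> lexsat n a"
    have "(\<lambda>i. u i + w i) \<in> lexify n J" if w: "w \<in> mons_deg n N" for w
    proof -
      have "(\<lambda>i. u i + w i) \<in> lexsat n a"
        using mono_idealD[OF lexsat_mono_ideal u] w by (simp add: mons_deg_def)
      moreover have "(\<lambda>i. u i + w i) \<in> mons_deg n (mdeg n u + N)"
        using u w by (simp add: lexsat_def mons_deg_def mdeg_add mons_add)
      ultimately show ?thesis using lexify_eq_lexsat_deg[OF N, of "mdeg n u + N"] by auto
    qed
    then show "u \<in> saturation n (lexify n J)" using u by (auto simp: saturation_def lexsat_def)
  qed
qed

text \<open>\<open>lexify n J\<close> has the Hilbert function of \<open>J\<close> in every degree,
  by Macaulay's theorem it is an ideal, and by \<open>lexify_subset_lexsat\<close> it lies inside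
  \<open>lexsat n a\<close>.\<close>

lemma hilb_fun_lexsat_le:
  assumes J: "mono_ideal n J"
    and ev: "\<forall>\<^sub>F d in sequentially. hilb_fun n J d = hilb_fun n (lexsat n a) d"
  shows "hilb_fun n (lexsat n a) e \<le> hilb_fun n J e"
proof -
  have "lexify n J \<inter> mons_deg n e \<subseteq> lexsat n a \<inter> mons_deg n e"
    using lexify_subset_lexsat[OF J ev, of _ 0] by (auto simp: mons_deg_def)
  then have "card (lexify n J \<inter> mons_deg n e) \<le> card (lexsat n a \<inter> mons_deg n e)"
    by (simp add: card_mono)
  then show ?thesis
    using hilb_fun_add_card[of n J e] hilb_fun_add_card[of n "lexsat n a" e]
    by (simp add: card_lexify_deg Int_commute)
qed

subsection \<open>Growth of Borel ideals\<close>

lemma mdeg_mono: "(\<And>k. k \<le> n \<Longrightarrow> u k \<le> v k) \<Longrightarrow> mdeg n u \<le> mdeg n v"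
  unfolding mdeg_def by (rule sum_mono) simp

lemma mdeg_le: "l \<le> n \<Longrightarrow> mdeg l u \<le> mdeg n u"
  unfolding mdeg_def by (rule sum_mono2) auto

lemma mdeg_zero_after:
  assumes "i \<le> n" "\<And>k. i < k \<Longrightarrow> k \<le> n \<Longrightarrow> u k = 0"
  shows "mdeg n u = mdeg i u"
  unfolding mdeg_def using assms by (intro sum.mono_neutral_right) auto

lemma borel_move:
  assumes "borel n I" "u \<in> I" "i < j" "j \<le> n" "0 < u j"
  shows "u(i := u i + 1, j := u j - 1) \<in> I"
  using assms by (simp add: borel_def)

lemma mdeg_move_Suc:
  assumes "0 < w (Suc l)"
  shows "mdeg k (w(l := w l + 1, Suc l := w (Suc l) - 1)) = mdeg k w + (if k = l then 1 else 0)"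
proof (cases k l rule: linorder_cases)
  case less
  then have "mdeg k (w(l := w l + 1, Suc l := w (Suc l) - 1)) = mdeg k w"
    by (intro mdeg_cong) auto
  then show ?thesis using less by simp
next
  case equal
  then have "mdeg k (w(l := w l + 1, Suc l := w (Suc l) - 1)) = mdeg k (w(l := w l + 1))"
    by (intro mdeg_cong) auto
  then show ?thesis using equal mdeg_incr[of l k w] by simp
next
  case greater
  then show ?thesis using mdeg_move[of l "Suc l" k w] assms by simp
qed

lemma mons_eqI_mdeg:
  assumes "u \<in> mons n" "v \<in> mons n" "\<And>l. l \<le> n \<Longrightarrow> mdeg l u = mdeg l v"
  shows "u = v"
proof
  fix k
  show "u k = v k"
  proof (cases "k \<le> n")
    case True
    show ?thesis
    proof (cases k)
      case 0
      then show ?thesis using assms(3)[of 0] by (simp add: mdeg_def)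
    next
      case (Suc j)
      then show ?thesis using assms(3)[of k] assms(3)[of j] True by (simp add: mdeg_Suc)
    qed
  next
    case False
    then show ?thesis using assms(1,2) by (simp add: mons_def)
  qed
qed

text \<open>Partial degrees turn the Borel order into a pointwise order: moving one unit from
  $x_{l+1}$ to $x_l$ raises only the partial degree at \<open>l\<close>, and multiplying by $x_n$
  raises only the one at \<open>n\<close>. The largest index with a deficit can always be raised,
  and the total deficit decreases.\<close>

lemma borel_dominance:
  assumes I: "mono_ideal n I" "borel n I"
    and "w \<in> I" "v \<in> mons n" "\<And>l. l \<le> n \<Longrightarrow> mdeg l w \<le> mdeg l v"
  shows "v \<in> I"
  using assms(3,5)
proof (induction "\<Sum>l\<le>n. mdeg l v - mdeg l w" arbitrary: w rule: less_induct)
  case less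
  have wn: "w \<in> mons n" using less.prems(1) I(1) by (auto simp: mono_ideal_def)
  define S where "S = {l. l \<le> n \<and> mdeg l w < mdeg l v}"
  show ?case
  proof (cases "S = {}")
    case True
    then have "mdeg l w = mdeg l v" if "l \<le> n" for l
      using less.prems(2)[OF that] that by (auto simp: S_def)
    then have "w = v" by (rule mons_eqI_mdeg[OF wn assms(4)])
    then show ?thesis using less.prems(1) by simp
  next
    case False
    define l where "l = Max S"
    have fin: "finite S" by (simp add: S_def)
    have "l \<in> S" unfolding l_def using fin False by (rule Max_in)
    then have l: "l \<le> n" "mdeg l w < mdeg l v" by (auto simp: S_def)
    have lmax: "mdeg k w = mdeg k v" if "l < k" "k \<le> n" for k
      using Max_ge[OF fin, of k] less.prems(2)[of k] that unfolding l_def S_def by fastforce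
    have "\<exists>w'\<in>I. \<forall>k\<le>n. mdeg k w' = mdeg k w + (if k = l then 1 else 0)"
    proof (cases "l = n")
      case True
      have "mdeg k (w(n := w n + 1)) = mdeg k w + (if k = l then 1 else 0)" if "k \<le> n" for k
      proof (cases "k = n")
        case False
        then have "mdeg k (w(n := w n + 1)) = mdeg k w" using that by (intro mdeg_cong) auto
        then show ?thesis using True False by simp
      qed (use True mdeg_incr[of n n w] in simp)
      then show ?thesis using mono_ideal_incr[OF I(1) less.prems(1), of n] by blast
    next
      case False
      then have "Suc l \<le> n" using l by simp
      \<comment> \<open>The partial degrees agree at \<open>l + 1\<close> while \<open>w\<close> is
        short at \<open>l\<close>, so the difference sits in the exponent of $x_{l+1}$.\<close>
      moreover have "0 < w (Suc l)" using lmax[of "Suc l"] l \<open>Suc l \<le> n\<close> by (simp add: mdeg_Suc)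
      ultimately have "w(l := w l + 1, Suc l := w (Suc l) - 1) \<in> I"
        by (intro borel_move[OF I(2) less.prems(1)]) auto
      then show ?thesis using mdeg_move_Suc[of w l] \<open>0 < w (Suc l)\<close> by blast
    qed
    then obtain w' where w': "w' \<in> I" "\<And>k. k \<le> n \<Longrightarrow> mdeg k w' = mdeg k w + (if k = l then 1 else 0)"
      by blast
    show ?thesis
    proof (rule less.hyps[OF _ w'(1)])
      show "(\<Sum>k\<le>n. mdeg k v - mdeg k w') < (\<Sum>k\<le>n. mdeg k v - mdeg k w)"
      proof (rule sum_strict_mono_ex1)
        show "\<exists>k\<in>{..n}. mdeg k v - mdeg k w' < mdeg k v - mdeg k w"
          using l w'(2)[of l] by (intro bexI[of _ l]) auto
      qed (use w' in auto)
      show "mdeg k w' \<le> mdeg k v" if "k \<le> n" for k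
        using less.prems(2)[OF that] w'(2)[OF that] l by (cases "k = l") auto
    qed
  qed
qed

section \<open>Counting monomials with a fixed or a bounded prefix\<close>

lemma sum_le_card_mult:
  fixes f :: "nat \<Rightarrow> nat"
  assumes "\<And>k. k \<in> A \<Longrightarrow> f k \<le> q"
  shows "sum f A \<le> card A * q"
  using sum_bounded_above[of A f q] assms by simp

text \<open>The exponents at positions \<open>i + 1\<close> to \<open>n - 1\<close> range freely
  over 0 to \<open>q\<close>, and $x_n$ absorbs what is left of \<open>n * q\<close>.\<close>

lemma card_prefix_ge:
  assumes "i < n"
  shows "(q + 1) ^ (n - i - 1) \<le> card {v \<in> mons_deg n (mdeg i a + n * q). \<forall>k\<le>i. v k = a k}"
proof -
  let ?J = "{i+1..<n}"
  let ?P = "\<Pi>\<^sub>E k\<in>?J. {..q}"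
  define F where "F f = (\<lambda>k. if k \<le> i then a k else if k < n then f k
    else if k = n then n * q - (\<Sum>k\<in>?J. f k) else 0)" for f :: "nat \<Rightarrow> nat"
  have inj: "inj_on F ?P"
  proof (rule inj_onI)
    fix f g assume fg: "f \<in> ?P" "g \<in> ?P" and eq: "F f = F g"
    have "f k = g k" if "k \<in> ?J" for k
      using fun_cong[OF eq, of k] that by (simp add: F_def split: if_splits)
    then show "f = g" using fg by (intro PiE_ext)
  qed
  have "F ` ?P \<subseteq> {v \<in> mons_deg n (mdeg i a + n * q). \<forall>k\<le>i. v k = a k}"
  proof (rule image_subsetI)
    fix f assume f: "f \<in> ?P"
    have "(\<Sum>k\<in>?J. f k) \<le> card ?J * q" using f by (intro sum_le_card_mult) auto
    also have "\<dots> \<le> n * q" by simp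
    finally have le: "(\<Sum>k\<in>?J. f k) \<le> n * q" .
    have split: "{..n} = {..i} \<union> (?J \<union> {n})" using assms by auto
    have "mdeg n (F f) = sum (F f) {..i} + (sum (F f) ?J + F f n)"
      unfolding mdeg_def split using assms by (subst sum.union_disjoint, auto)+
    moreover have "sum (F f) {..i} = mdeg i a" unfolding mdeg_def by (rule sum.cong) (auto simp: F_def)
    moreover have "sum (F f) ?J = sum f ?J" by (rule sum.cong) (auto simp: F_def)
    moreover have "F f n = n * q - sum f ?J" using assms by (simp add: F_def)
    ultimately have "mdeg n (F f) = mdeg i a + n * q" using le by simp
    moreover have "F f \<in> mons n" using assms by (simp add: F_def mons_def)
    ultimately show "F f \<in> {v \<in> mons_deg n (mdeg i a + n * q). \<forall>k\<le>i. v k = a k}"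
      by (simp add: mons_deg_def F_def)
  qed
  then have "card (F ` ?P) \<le> card {v \<in> mons_deg n (mdeg i a + n * q). \<forall>k\<le>i. v k = a k}"
    by (intro card_mono) auto
  moreover have "card ?P = (q + 1) ^ (n - i - 1)" by (simp add: card_PiE)
  ultimately show ?thesis using card_image[OF inj] by simp
qed

lemma card_bounded_prefix_le:
  assumes "j < n"
  shows "card {v \<in> mons_deg n e. mdeg j v \<le> K} \<le> (K + 1) ^ (j + 1) * (e + 1) ^ (n - j - 1)"
proof -
  let ?P = "\<Pi>\<^sub>E k\<in>{..<n}. if k \<le> j then {..K} else {..e}"
  let ?A = "{v \<in> mons_deg n e. mdeg j v \<le> K}"
  have le: "u k \<le> mdeg l u" if "k \<le> l" for u :: "nat \<Rightarrow> nat" and k l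
    unfolding mdeg_def using that by (intro member_le_sum) auto
  have inj: "inj_on (\<lambda>v. restrict v {..<n}) ?A"
  proof (rule inj_onI)
    fix u v assume uv: "u \<in> ?A" "v \<in> ?A" and eq: "restrict u {..<n} = restrict v {..<n}"
    have "u k = v k" if "k < n" for k using fun_cong[OF eq, of k] that by simp
    then show "u = v" using uv by (intro mons_deg_unique[of u n e v]) auto
  qed
  have "(\<lambda>v. restrict v {..<n}) ` ?A \<subseteq> ?P"
  proof (rule image_subsetI)
    fix v assume "v \<in> ?A"
    then have v: "mdeg n v = e" "mdeg j v \<le> K" by (auto simp: mons_deg_def)
    then have "v k \<le> e" if "k < n" for k using le[of k n v] that by simp
    moreover have "v k \<le> K" if "k \<le> j" for k using le[OF that, of v] v by simp
    ultimately show "restrict v {..<n} \<in> ?P" by auto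
  qed
  moreover have "finite ?P" by (rule finite_PiE) auto
  ultimately have "card ((\<lambda>v. restrict v {..<n}) ` ?A) \<le> card ?P" by (intro card_mono)
  also have "card ?P = (\<Prod>k<n. if k \<le> j then K + 1 else e + 1)"
    by (simp add: card_PiE if_distrib[of card] cong: if_cong)
  also have "\<dots> = (\<Prod>k\<in>{..j} \<union> {j+1..<n}. if k \<le> j then K + 1 else e + 1)"
    by (rule prod.cong) (use assms in auto)
  also have "\<dots> = (\<Prod>k\<le>j. if k \<le> j then K + 1 else e + 1) * (\<Prod>k\<in>{j+1..<n}. if k \<le> j then K + 1 else e + 1)"
    by (rule prod.union_disjoint) auto
  also have "(\<Prod>k\<le>j. if k \<le> j then K + 1 else e + 1) = (\<Prod>k\<le>j. K + 1)" by (rule prod.cong) auto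
  also have "(\<Prod>k\<in>{j+1..<n}. if k \<le> j then K + 1 else e + 1) = (\<Prod>k\<in>{j+1..<n}. e + 1)"
    by (rule prod.cong) auto
  finally show ?thesis unfolding card_image[OF inj] by simp
qed

text \<open>Fixing the exponents up to \<open>i\<close> leaves growth of order
  \<open>n - i - 1\<close> in the degree; bounding the partial degree at \<open>i + 1\<close> leaves
  only order \<open>n - i - 2\<close>.\<close>

lemma prefix_growth:
  assumes "i + 1 < n"
  shows "\<exists>e\<ge>N. card {v \<in> mons_deg n e. mdeg (Suc i) v \<le> K} < card {v \<in> mons_deg n e. \<forall>k\<le>i. v k = a k}"
proof -
  \<comment> \<open>In degree \<open>e = s + n * q\<close> one has
    \<open>e + 1 \<le> (s + n + 1) * (q + 1)\<close>. \<open>C\<close> collects all of the upper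
    bound except \<open>(q + 1) ^ p\<close>, and \<open>q \<ge> C\<close> lets one further factor
    \<open>q + 1\<close> beat it.\<close>
  define s p C where "s = mdeg i a" and "p = n - i - 2" and "C = (K + 1) ^ (i + 2) * (s + n + 1) ^ p"
  define q where "q = max C N"
  let ?e = "s + n * q"
  have "N \<le> n * q" using assms unfolding q_def by (cases n) auto
  then have "N \<le> ?e" by simp
  moreover have "card {v \<in> mons_deg n ?e. mdeg (Suc i) v \<le> K} \<le> (K + 1) ^ (i + 2) * (?e + 1) ^ p"
    using card_bounded_prefix_le[of "Suc i" n ?e K] assms by (simp add: p_def)
  moreover have "(K + 1) ^ (i + 2) * (?e + 1) ^ p \<le> (K + 1) ^ (i + 2) * ((s + n + 1) * (q + 1)) ^ p"
    by (intro mult_left_mono power_mono) (auto simp: algebra_simps)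
  moreover have "(K + 1) ^ (i + 2) * ((s + n + 1) * (q + 1)) ^ p = C * (q + 1) ^ p"
    by (simp only: C_def power_mult_distrib mult.assoc)
  moreover have "C * (q + 1) ^ p < (q + 1) * (q + 1) ^ p"
    by (rule mult_strict_right_mono) (auto simp: q_def)
  moreover have "(q + 1) * (q + 1) ^ p = (q + 1) ^ (n - i - 1)"
    using assms by (simp add: p_def flip: power_Suc Suc_diff_le)
  moreover have "(q + 1) ^ (n - i - 1) \<le> card {v \<in> mons_deg n ?e. \<forall>k\<le>i. v k = a k}"
    using card_prefix_ge[of i n q a] assms by (simp add: s_def)
  ultimately show ?thesis by (intro exI[of _ ?e]) linarith
qed

text \<open>If \<open>u\<close> fell below \<open>a\<close> at \<open>i\<close>,
  \<open>lexsat n a\<close> would miss the whole cylinder over the prefix of \<open>u\<close>, while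
  by dominance \<open>I\<close> contains every monomial in it of large partial degree at
  \<open>i + 1\<close>. This contradicts \<open>prefix_growth\<close>. The premise
  \<open>bounded\<close> controls the monomials already above \<open>a\<close> before
  \<open>i\<close>.\<close>

lemma borel_exponent_ge:
  assumes I: "mono_ideal n I" "borel n I" and i: "i + 1 < n"
    and ev: "\<forall>\<^sub>F e in sequentially. hilb_fun n (lexsat n a) e \<le> hilb_fun n I e"
    and u: "u \<in> I" "\<forall>k<i. u k = a k"
    and bounded: "\<And>v. v \<in> mons n \<Longrightarrow> v \<notin> I \<Longrightarrow> \<not> below i a v \<Longrightarrow> \<exists>k<i. v k \<noteq> a k \<Longrightarrow> mdeg (Suc i) v \<le> K"
  shows "a i \<le> u i"
proof (rule ccontr)
  assume "\<not> a i \<le> u i"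
  \<comment> \<open>Partial degree above \<open>K'\<close> serves twice: it exceeds the bound in
    \<open>bounded\<close>, and it outweighs the full degree of \<open>u\<close>.\<close>
  define t K' where "t = u i" and "K' = max K (mdeg n u)"
  have t: "t < a i" using \<open>\<not> a i \<le> u i\<close> by (simp add: t_def)
  obtain N where N: "\<And>e. e \<ge> N \<Longrightarrow> hilb_fun n (lexsat n a) e \<le> hilb_fun n I e"
    using ev by (auto simp: eventually_sequentially)
  obtain e where "e \<ge> N" and less: "card {v \<in> mons_deg n e. mdeg (Suc i) v \<le> K'}
      < card {v \<in> mons_deg n e. \<forall>k\<le>i. v k = (a(i := t)) k}"
    using prefix_growth[OF i] by blast
  \<comment> \<open>\<open>lexsat n a\<close> misses the disjoint sets \<open>B\<close> and
    \<open>E\<close>, whereas \<open>I\<close> misses at most \<open>B\<close> and the thin set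
    \<open>S\<close>.\<close>
  define B where "B = {v \<in> mons_deg n e. below i a v \<or> (\<forall>k<i. v k = a k) \<and> v i < t}"
  define E where "E = {v \<in> mons_deg n e. \<forall>k\<le>i. v k = (a(i := t)) k}"
  define S where "S = {v \<in> mons_deg n e. mdeg (Suc i) v \<le> K'}"
  have E_iff: "v \<in> E \<longleftrightarrow> v \<in> mons_deg n e \<and> (\<forall>k<i. v k = a k) \<and> v i = t" for v
    unfolding E_def by (auto simp: le_less)
  have fin: "finite B" "finite E" "finite S"
    by (auto simp: B_def E_def S_def)
  have "B \<inter> E = {}" using below_def by (auto simp: B_def E_iff)
  have "B \<union> E \<subseteq> mons_deg n e - lexsat n a"
  proof
    fix v assume v: "v \<in> B \<union> E"
    have "below (Suc i) a v" using v t by (auto simp: below_Suc B_def E_iff)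
    then have "below n a v" using i by (auto intro: below_mono)
    then show "v \<in> mons_deg n e - lexsat n a" using v by (auto simp: B_def E_iff lexsat_def)
  qed
  then have "card (B \<union> E) \<le> hilb_fun n (lexsat n a) e"
    unfolding hilb_fun_def by (intro card_mono) auto
  also have "\<dots> \<le> hilb_fun n I e" using N \<open>e \<ge> N\<close> by simp
  also have "\<dots> \<le> card (B \<union> S)"
    unfolding hilb_fun_def
  proof (rule card_mono)
    show "mons_deg n e - I \<subseteq> B \<union> S"
    proof
      fix v assume "v \<in> mons_deg n e - I"
      then have v: "v \<in> mons_deg n e" "v \<in> mons n" "v \<notin> I" by (auto simp: mons_deg_def)
      show "v \<in> B \<union> S"
      proof (rule ccontr)
        assume nv: "v \<notin> B \<union> S"
        then have nb: "\<not> below i a v" and big: "K' < mdeg (Suc i) v"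
          and "\<not> ((\<forall>k<i. v k = a k) \<and> v i < t)"
          using v by (auto simp: B_def S_def)
        moreover have eq: "\<forall>k<i. v k = a k"
          using bounded[OF v(2,3) nb] big by (force simp: K'_def)
        ultimately have vi: "u i \<le> v i" by (simp add: t_def)
        have "mdeg l u \<le> mdeg l v" if "l \<le> n" for l
        proof (cases "l \<le> i")
          case True
          have "u k \<le> v k" if "k \<le> l" for k
            using that True u(2) eq vi by (cases "k = i") auto
          then show ?thesis by (rule mdeg_mono)
        next
          case False
          have "mdeg l u \<le> mdeg n u" using that by (rule mdeg_le)
          also have "\<dots> \<le> mdeg (Suc i) v" using big by (simp add: K'_def)
          also have "\<dots> \<le> mdeg l v" using False by (intro mdeg_le) simp
          finally show ?thesis .
        qed
        then show False using borel_dominance[OF I u(1) v(2)] v(3) by blast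
      qed
    qed
  qed (use fin in simp)
  also have "\<dots> \<le> card B + card S" by (rule card_Un_le)
  finally have "card E \<le> card S" using card_Un_disjoint[OF fin(1,2) \<open>B \<inter> E = {}\<close>] by simp
  then show False using less by (simp add: E_def S_def)
qed

text \<open>The smallest monomial under divisibility that first exceeds \<open>a\<close> at
  \<open>k\<close>. For \<open>k < n\<close>, together with the monomial with exponents
  $a_0,...,a_{n-1}$, these generate \<open>lexsat n a\<close>.\<close>

definition lexgen :: "(nat \<Rightarrow> nat) \<Rightarrow> nat \<Rightarrow> (nat \<Rightarrow> nat)" where
  "lexgen a k = (\<lambda>l. if l < k then a l else if l = k then a k + 1 else 0)"

lemma first_difference:
  assumes "\<not> below i a v" "\<exists>k<i. v k \<noteq> a k"
  shows "\<exists>k<i. (\<forall>l<k. v l = a l) \<and> a k < v k"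
proof -
  define k where "k = (LEAST k. v k \<noteq> a k)"
  have k: "v k \<noteq> a k" unfolding k_def using assms(2) LeastI_ex[of "\<lambda>k. v k \<noteq> a k"] by blast
  have ki: "k < i" unfolding k_def using assms(2) Least_le[of "\<lambda>k. v k \<noteq> a k"] by (meson le_less_trans)
  have eq: "\<forall>l<k. v l = a l" unfolding k_def using not_less_Least by blast
  have "\<not> v k < a k" using assms(1) eq ki unfolding below_def by blast
  then show ?thesis using k ki eq by (metis nat_neq_iff)
qed

lemma not_below_if_greater:
  assumes "\<forall>l<k. v l = a l" "a k < v k"
  shows "\<not> below n a v"
proof
  assume "below n a v"
  then obtain j where "\<forall>l<j. v l = a l" "v j < a j" unfolding below_def by blast
  then show False using assms by (cases j k rule: linorder_cases) auto
qed

lemma lexgen_mons: "k \<le> n \<Longrightarrow> lexgen a k \<in> mons n"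
  by (simp add: lexgen_def mons_def)

lemma lexgen_dvd:
  assumes "mono_ideal n I" "lexgen a k \<in> I" "v \<in> mons n" "\<forall>l<k. v l = a l" "a k < v k"
  shows "v \<in> I"
  by (rule mono_ideal_dvd[OF assms(1,2,3)]) (use assms(4,5) in \<open>simp add: lexgen_def\<close>)

text \<open>Two invariants advance together: nothing in \<open>I\<close> falls below
  \<open>a\<close> before \<open>i\<close>, and \<open>I\<close> contains the generators of index
  below \<open>i\<close>. The second makes \<open>bounded\<close> in
  \<open>borel_exponent_ge\<close> vacuous; the first confines \<open>I\<close> in the degree of the
  next generator. At \<open>m\<close> the induction stops, since \<open>a m = 0\<close> cannot be
  undercut.\<close>

lemma borel_subset_lexsat:
  assumes I: "mono_ideal n I" "borel n I" and n: "n = Suc m" and am: "a m = 0"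
    and hilb: "\<And>e. hilb_fun n I e = hilb_fun n (lexsat n a) e"
  shows "I \<subseteq> lexsat n a"
proof -
  have "(\<forall>u\<in>I. \<not> below i a u) \<and> (\<forall>k<i. lexgen a k \<in> I)" if "i \<le> m" for i
    using that
  proof (induction i)
    case 0
    then show ?case by (simp add: below_def)
  next
    case (Suc i)
    then have nb: "\<And>u. u \<in> I \<Longrightarrow> \<not> below i a u" and gens: "\<And>k. k < i \<Longrightarrow> lexgen a k \<in> I" by auto
    have i: "i + 1 < n" using Suc.prems n by simp
    have vac: "v \<in> I" if "v \<in> mons n" "\<not> below i a v" "\<exists>k<i. v k \<noteq> a k" for v
      using first_difference[OF that(2,3)] lexgen_dvd[OF I(1) gens that(1)] by blast
    have nbS: "\<not> below (Suc i) a u" if u: "u \<in> I" for u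
    proof
      assume "below (Suc i) a u"
      then have "\<forall>k<i. u k = a k" "u i < a i" using nb[OF u] by (auto simp: below_Suc)
      moreover from this have "a i \<le> u i"
        using vac hilb by (intro borel_exponent_ge[OF I i _ u]) auto
      ultimately show False by simp
    qed
    have "lexgen a i \<in> I"
    proof (rule ccontr)
      assume nin: "lexgen a i \<notin> I"
      define D where "D = mdeg n (lexgen a i)"
      have gm: "lexgen a i \<in> mons n" using i by (intro lexgen_mons) simp
      have "mons_deg n D \<inter> I \<subseteq> mons_deg n D \<inter> lexsat n a"
      proof
        fix v assume v: "v \<in> mons_deg n D \<inter> I"
        have "\<exists>k<Suc i. v k \<noteq> a k"
        proof (rule ccontr)
          assume "\<not> ?thesis"
          then have eq: "v k = a k" if "k \<le> i" for k using that by (simp add: less_Suc_eq_le)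
          \<comment> \<open>\<open>lexgen a i\<close> has the prefix of \<open>v\<close> with one
            more $x_i$ and nothing afterwards, so in equal degree its partial degrees are at least
            those of \<open>v\<close>.\<close>
          have "mdeg l v \<le> mdeg l (lexgen a i)" if "l \<le> n" for l
          proof (cases "l \<le> i")
            case True
            have "v k \<le> lexgen a i k" if "k \<le> l" for k
              using that True eq[of k] by (cases "k = i") (auto simp: lexgen_def)
            then show ?thesis by (rule mdeg_mono)
          next
            case False
            have "mdeg l v \<le> mdeg n v" using that by (rule mdeg_le)
            also have "\<dots> = mdeg n (lexgen a i)" using v by (simp add: D_def mons_deg_def)
            also have "\<dots> = mdeg l (lexgen a i)" using that False by (intro mdeg_zero_after) (auto simp: lexgen_def)
            finally show ?thesis .
          qed
          then show False using borel_dominance[OF I _ gm, of v] v nin by blast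
        qed
        then obtain k where "\<forall>l<k. v l = a l" "a k < v k"
          using first_difference[OF nbS, of v] v by blast
        then show "v \<in> mons_deg n D \<inter> lexsat n a"
          using v not_below_if_greater by (auto simp: lexsat_def mons_deg_def)
      qed
      moreover have "\<not> below n a (lexgen a i)"
        by (rule not_below_if_greater[of i]) (auto simp: lexgen_def)
      then have "lexgen a i \<in> mons_deg n D \<inter> lexsat n a"
        using gm by (simp add: lexsat_def mons_deg_def D_def)
      ultimately have "card (mons_deg n D \<inter> I) < card (mons_deg n D \<inter> lexsat n a)"
        using nin by (intro psubset_card_mono) auto
      then show False
        using hilb[of D] hilb_fun_add_card[of n I D] hilb_fun_add_card[of n "lexsat n a" D] by simp
    qed
    then show ?case using nbS gens by (auto simp: less_Suc_eq)
  qed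
  from this[of m] have "\<not> below n a u" if "u \<in> I" for u
    using that am n by (auto simp: below_Suc)
  then show ?thesis using I(1) by (auto simp: lexsat_def mono_ideal_def)
qed

section \<open>Eliminating the last variable\<close>

lemma saturated_borel_upd_last:
  assumes I: "mono_ideal n I" "borel n I" "saturated n I" and u: "u \<in> mons n"
  shows "u(n := x) \<in> I \<longleftrightarrow> u \<in> I"
proof -
  have drop: "v \<in> I" if v: "v \<in> mons n" "v(n := v n + k) \<in> I" for v k
  proof -
    \<comment> \<open>Borel moves carry $x_n^k$ to every monomial of degree \<open>k\<close>, so $v
      x_n^k$ in \<open>I\<close> puts \<open>v\<close> into the saturation.\<close>
    have "(\<lambda>i. v i + w i) \<in> I" if w: "w \<in> mons_deg n k" for w
    proof (rule borel_dominance[OF I(1,2) v(2)])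
      show "(\<lambda>i. v i + w i) \<in> mons n" using v w by (simp add: mons_deg_def mons_add)
      show "mdeg l (v(n := v n + k)) \<le> mdeg l (\<lambda>i. v i + w i)" if "l \<le> n" for l
      proof (cases "l = n")
        case True
        then show ?thesis using mdeg_upd[of n n v "v n + k"] w by (simp add: mdeg_add mons_deg_def)
      next
        case False
        then show ?thesis using that by (intro mdeg_mono) auto
      qed
    qed
    then have "v \<in> saturation n I" using v by (auto simp: saturation_def)
    then show ?thesis using I(3) by (simp add: saturated_def)
  qed
  have "v(n := y) \<in> I" if "v \<in> mons n" "v \<in> I" for v y
    using drop[of "v(n := y)" "v n"] mono_ideal_upd_last[OF I(1) that(2), of "y + v n"] that
    by (simp add: mons_upd)
  from this[OF u] this[of "u(n := x)" "u n"] show ?thesis using u by (auto simp: mons_upd)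
qed

text \<open>Counts dimensions in the exact sequence of multiplication by $x_{m+1}$, which is
  injective modulo \<open>X\<close> by \<open>free\<close>.\<close>

lemma hilb_fun_Suc:
  assumes free: "\<And>u x. u \<in> mons (Suc m) \<Longrightarrow> u(Suc m := x) \<in> X \<longleftrightarrow> u \<in> X"
  shows "hilb_fun (Suc m) X (Suc d) = hilb_fun (Suc m) X d + hilb_fun m (X \<inter> mons m) (Suc d)"
proof -
  let ?f = "\<lambda>u :: nat \<Rightarrow> nat. u(Suc m := u (Suc m) + 1)"
  let ?A = "mons_deg (Suc m) d - X" and ?B = "mons_deg m (Suc d) - X \<inter> mons m"
  have inj: "inj_on ?f ?A"
    by (rule inj_on_incr)
  have B_last: "u (Suc m) = 0" if "u \<in> ?B" for u using that by (auto simp: mons_deg_def mons_def)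
  have "mons_deg (Suc m) (Suc d) - X = ?f ` ?A \<union> ?B"
  proof (intro subset_antisym Un_least subsetI)
    fix u assume u: "u \<in> mons_deg (Suc m) (Suc d) - X"
    show "u \<in> ?f ` ?A \<union> ?B"
    proof (cases "u (Suc m) = 0")
      case True
      then have "u(Suc m := 0) = u" by auto
      then have "u \<in> mons m" using mons_Suc_drop[of u m] u by (simp add: mons_deg_def)
      then show ?thesis using u True by (simp add: mons_deg_def mdeg_Suc)
    next
      case False
      let ?w = "u(Suc m := u (Suc m) - 1)"
      have "?w \<in> ?A" using u False mons_deg_decr[of u "Suc m" d "Suc m"] free by (auto simp: mons_deg_def)
      moreover have "u = ?f ?w" using False by auto
      ultimately show ?thesis by blast
    qed
  next
    fix z assume "z \<in> ?f ` ?A"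
    then obtain u where u: "u \<in> ?A" "z = ?f u" by blast
    then have "z \<in> mons_deg (Suc m) (Suc d)" using mons_deg_incr[of u "Suc m" d "Suc m"] by simp
    moreover have "z \<notin> X" using u free[of u] by (simp add: mons_deg_def)
    ultimately show "z \<in> mons_deg (Suc m) (Suc d) - X" by simp
  next
    fix u assume u: "u \<in> ?B"
    then show "u \<in> mons_deg (Suc m) (Suc d) - X"
      using B_last[OF u] by (auto simp: mons_deg_def mdeg_Suc mons_mono)
  qed
  moreover have "card (?f ` ?A \<union> ?B) = card (?f ` ?A) + card ?B"
    by (rule card_Un_disjoint) (use B_last in fastforce)+
  ultimately show ?thesis unfolding hilb_fun_def using card_image[OF inj] by simp
qed

lemma hilb_fun_0:
  assumes free: "\<And>u x. u \<in> mons (Suc m) \<Longrightarrow> u(Suc m := x) \<in> X \<longleftrightarrow> u \<in> X"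
  shows "hilb_fun (Suc m) X 0 = hilb_fun m (X \<inter> mons m) 0"
proof -
  have "mons_deg (Suc m) 0 = mons_deg m 0"
  proof (intro subset_antisym subsetI)
    fix u assume u: "u \<in> mons_deg (Suc m) 0"
    then have "u(Suc m := 0) = u" by (auto simp: mons_deg_def mdeg_Suc)
    then have "u \<in> mons m" using mons_Suc_drop[of u m] u by (simp add: mons_deg_def)
    then show "u \<in> mons_deg m 0" using u by (simp add: mons_deg_def mdeg_Suc)
  next
    fix u assume u: "u \<in> mons_deg m 0"
    then have "u (Suc m) = 0" by (simp add: mons_deg_def mons_def)
    then show "u \<in> mons_deg (Suc m) 0" using u by (simp add: mons_deg_def mdeg_Suc mons_mono)
  qed
  then show ?thesis unfolding hilb_fun_def by (intro arg_cong[of _ _ card]) (auto simp: mons_deg_def)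
qed

text \<open>\<open>lexsat m a\<close> ignores the exponent of $x_m$, while
  \<open>lexsat (Suc m) a\<close> compares it with \<open>a m\<close>; a zero threshold makes that
  comparison empty.\<close>

lemma lexsat_Int_mons:
  assumes "a m = 0"
  shows "lexsat (Suc m) a \<inter> mons m = lexsat m a"
  using assms by (auto simp: lexsat_def below_Suc mons_mono)

text \<open>The first differences of both Hilbert functions are Hilbert functions in one variable less,
  and there the lexicographic one is minimal; equality of the sums in large degree therefore forces
  equality everywhere.\<close>

lemma hilb_fun_eq_lexsat:
  assumes I: "mono_ideal n I" "borel n I" "saturated n I" and n: "n = Suc m" and am: "a m = 0"
    and ev: "\<forall>\<^sub>F e in sequentially. hilb_fun n I e = hilb_fun n (lexsat n a) e"
  shows "hilb_fun n I e = hilb_fun n (lexsat n a) e"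
proof -
  let ?L = "lexsat n a"
  let ?I' = "I \<inter> mons m" and ?L' = "lexsat m a"
  have freeI: "u(Suc m := x) \<in> I \<longleftrightarrow> u \<in> I" if "u \<in> mons (Suc m)" for u x
    using saturated_borel_upd_last[OF I] that n by simp
  have freeL: "u(Suc m := x) \<in> ?L \<longleftrightarrow> u \<in> ?L" if "u \<in> mons (Suc m)" for u x
    using lexsat_upd_last that n by simp
  have stepI: "hilb_fun n I (Suc d) = hilb_fun n I d + hilb_fun m ?I' (Suc d)"
    and startI: "hilb_fun n I 0 = hilb_fun m ?I' 0" for d
    using hilb_fun_Suc[of m I, OF freeI] hilb_fun_0[of m I, OF freeI] n by simp_all
  have stepL: "hilb_fun n ?L (Suc d) = hilb_fun n ?L d + hilb_fun m ?L' (Suc d)"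
    and startL: "hilb_fun n ?L 0 = hilb_fun m ?L' 0" for d
    using hilb_fun_Suc[of m ?L, OF freeL] hilb_fun_0[of m ?L, OF freeL] lexsat_Int_mons[of a m, OF am] n by simp_all
  have J: "mono_ideal m ?I'"
    using mono_idealD[OF I(1)] n by (auto simp: mono_ideal_def mons_add mons_mono)
  obtain N where N: "\<And>d. d \<ge> N \<Longrightarrow> hilb_fun n I d = hilb_fun n ?L d"
    using ev by (auto simp: eventually_sequentially)
  have "hilb_fun m ?I' d = hilb_fun m ?L' d" if "d \<ge> Suc N" for d
    using stepI[of "d - 1"] stepL[of "d - 1"] N[of d] N[of "d - 1"] that by simp
  then have ev': "\<forall>\<^sub>F d in sequentially. hilb_fun m ?I' d = hilb_fun m ?L' d"
    unfolding eventually_sequentially by blast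
  have le: "hilb_fun m ?L' d \<le> hilb_fun m ?I' d" for d
    by (rule hilb_fun_lexsat_le[OF J ev'])
  have "hilb_fun n I d \<ge> hilb_fun n ?L d" for d
    by (induction d) (use stepI stepL startI startL le in \<open>auto intro: add_mono\<close>)
  \<comment> \<open>From \<open>d\<close> to \<open>d + k\<close> the function of \<open>I\<close>
    grows at least as much, written without subtraction. Agreement at \<open>e + N\<close> then
    gives the reverse inequality at \<open>e\<close>.\<close>
  moreover have "hilb_fun n I (d + k) + hilb_fun n ?L d \<ge> hilb_fun n ?L (d + k) + hilb_fun n I d" for d k
  proof (induction k)
    case (Suc k)
    then show ?case using stepI[of "d + k"] stepL[of "d + k"] le[of "Suc (d + k)"] by simp
  qed simp
  then have "hilb_fun n I e \<le> hilb_fun n ?L e"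
    using N[of "e + N"] by (metis add_le_cancel_left le_add2)
  ultimately show ?thesis by (simp add: order_antisym)
qed

subsection \<open>Hilbert polynomials of lexicographic ideals\<close>

text \<open>Stars and bars for the \<open>n - i\<close> exponents after position \<open>i\<close>,
  whose sum is \<open>d - mdeg i a\<close>.\<close>

lemma card_prefix_eq:
  assumes i: "i < n" and d: "mdeg i a \<le> d"
  shows "card {u \<in> mons_deg n d. \<forall>k\<le>i. u k = a k} = (d - mdeg i a + (n - 1 - i)) choose (n - 1 - i)"
proof -
  let ?U = "{u \<in> mons_deg n d. \<forall>k\<le>i. u k = a k}"
  define D where "D = d - mdeg i a"
  let ?M = "{l :: nat list. length l = n - i \<and> sum_list l = D}"
  define G where "G l = (\<lambda>k. if k \<le> i then a k else if k \<le> n then l ! (k - i - 1) else 0)" for l :: "nat list"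
  have split: "mdeg n u = mdeg i u + sum_list (map u [i+1..<n+1])" for u
  proof -
    have "{..n} = {..i} \<union> {i+1..<n+1}" using i by auto
    then have "mdeg n u = sum u {..i} + sum u {i+1..<n+1}"
      unfolding mdeg_def by (simp only:) (subst sum.union_disjoint, auto)
    then show ?thesis by (simp add: mdeg_def sum_set_upt_conv_sum_list_nat[symmetric] del: upt_Suc)
  qed
  have map_G: "map (G l) [i+1..<n+1] = l" if "length l = n - i" for l
    by (rule nth_equalityI) (use that i in \<open>auto simp: G_def simp del: upt_Suc\<close>)
  have pre: "mdeg i u = mdeg i a" if "\<forall>k\<le>i. u k = a k" for u
    using that by (intro mdeg_cong) simp
  have "bij_betw (\<lambda>u. map u [i+1..<n+1]) ?U ?M"
  proof (rule bij_betw_byWitness[where f' = G])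
    show "\<forall>u\<in>?U. G (map u [i+1..<n+1]) = u"
    proof (intro ballI ext)
      fix u k assume u: "u \<in> ?U"
      have "[i+1..<n+1] ! (k - i - 1) = k" "k - i - 1 < length [i+1..<n+1]" if "i < k" "k \<le> n"
        using that by (auto simp del: upt_Suc)
      moreover have "u k = 0" if "n < k" using u that by (simp add: mons_deg_def mons_def)
      ultimately show "G (map u [i+1..<n+1]) k = u k"
        using u by (simp add: G_def del: upt_Suc)
    qed
    show "\<forall>l\<in>?M. map (G l) [i+1..<n+1] = l" using map_G by blast
    show "(\<lambda>u. map u [i+1..<n+1]) ` ?U \<subseteq> ?M"
    proof (rule image_subsetI)
      fix u assume u: "u \<in> ?U"
      then have "mdeg i a + sum_list (map u [i+1..<n+1]) = d"
        using split[of u] pre[of u] by (simp add: mons_deg_def del: upt_Suc)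
      then show "map u [i+1..<n+1] \<in> ?M" by (simp add: D_def del: upt_Suc)
    qed
    show "G ` ?M \<subseteq> ?U"
    proof (rule image_subsetI)
      fix l assume "l \<in> ?M"
      then have l: "length l = n - i" "sum_list l = D" by auto
      have G: "\<forall>k\<le>i. G l k = a k" by (simp add: G_def)
      have "mdeg n (G l) = mdeg i a + D" using split[of "G l"] pre[OF G] map_G[OF l(1)] l by simp
      then have "mdeg n (G l) = d" using d by (simp add: D_def)
      moreover have "G l \<in> mons n" using i by (simp add: G_def mons_def)
      ultimately show "G l \<in> ?U" using G by (simp add: mons_deg_def)
    qed
  qed
  then have "card ?U = card ?M" by (rule bij_betw_same_card)
  also have "\<dots> = (D + (n - i) - 1) choose D" by (rule card_length_sum_list)
  also have "D + (n - i) - 1 = D + (n - 1 - i)" using i by simp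
  also have "(D + (n - 1 - i)) choose D = (D + (n - 1 - i)) choose (n - 1 - i)"
    using binomial_symmetric[of D "D + (n - 1 - i)"] by simp
  finally show ?thesis by (simp add: D_def)
qed

lemma card_prefix_one:
  assumes "mdeg m a \<le> d"
  shows "card {u \<in> mons_deg (Suc m) d. \<forall>k\<le>m. u k = a k} = 1"
  using card_prefix_eq[of m "Suc m" a d] assms by simp

text \<open>With zeros after \<open>i\<close> a monomial can fall short only at positions up to
  \<open>i\<close>, so raising \<open>a i\<close> affects just the prefix equal to
  \<open>a\<close>.\<close>

lemma below_upd_Suc:
  assumes i: "i < n" and zero: "\<And>k. i < k \<Longrightarrow> k < n \<Longrightarrow> a k = 0"
  shows "below n (a(i := a i + 1)) u \<longleftrightarrow> below n a u \<or> (\<forall>k\<le>i. u k = a k)"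
proof
  let ?a = "a(i := a i + 1)"
  assume "below n ?a u"
  then obtain j where j: "j < n" "\<forall>k<j. u k = ?a k" "u j < ?a j" unfolding below_def by blast
  have ji: "j \<le> i"
  proof (rule ccontr)
    assume "\<not> j \<le> i"
    then show False using j zero[of j] by simp
  qed
  then have eq: "u k = a k" if "k < j" for k using j(2) that by auto
  show "below n a u \<or> (\<forall>k\<le>i. u k = a k)"
  proof (cases "u j < a j")
    case True
    then show ?thesis using j(1) eq by (intro disjI1 belowI[of j]) auto
  next
    case False
    then have "j = i" "u i = a i" using j(3) ji by (auto split: if_splits)
    then show ?thesis using eq by (auto simp: le_less)
  qed
next
  let ?a = "a(i := a i + 1)"
  assume "below n a u \<or> (\<forall>k\<le>i. u k = a k)"
  then show "below n ?a u"
  proof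
    assume "below n a u"
    then obtain j where j: "j < n" "\<forall>k<j. u k = a k" "u j < a j" unfolding below_def by blast
    show ?thesis
    proof (rule belowI[OF j(1)])
      show "u k \<le> ?a k" if "k < j" for k using j(2) that by simp
      show "u j < ?a j" using j(3) by (cases "j = i") auto
    qed
  next
    assume "\<forall>k\<le>i. u k = a k"
    then show ?thesis by (intro belowI[OF i]) auto
  qed
qed

lemma hilb_fun_lexsat_upd:
  assumes i: "i < n" and zero: "\<And>k. i < k \<Longrightarrow> k < n \<Longrightarrow> a k = 0"
  shows "hilb_fun n (lexsat n (a(i := a i + 1))) d =
    hilb_fun n (lexsat n a) d + card {u \<in> mons_deg n d. \<forall>k\<le>i. u k = a k}"
proof -
  let ?A = "mons_deg n d - lexsat n a" and ?B = "{u \<in> mons_deg n d. \<forall>k\<le>i. u k = a k}"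
  have "mons_deg n d - lexsat n (a(i := a i + 1)) = ?A \<union> ?B"
    using below_upd_Suc[of i n a, OF i zero] by (auto simp: lexsat_def mons_deg_def)
  moreover have "\<not> below n a u" if "\<forall>k\<le>i. u k = a k" for u
  proof
    assume "below n a u"
    then obtain j where j: "j < n" "u j < a j" unfolding below_def by blast
    then show False using that zero[of j] by (cases "j \<le> i") auto
  qed
  then have "?A \<inter> ?B = {}" by (auto simp: lexsat_def mons_deg_def)
  ultimately show ?thesis unfolding hilb_fun_def by (simp add: card_Un_disjoint)
qed

definition expo :: "nat \<Rightarrow> nat list \<Rightarrow> nat \<Rightarrow> nat" where
  "expo n b k = (if k < n then count_list b (n - 1 - k) else 0)"

text \<open>All entries of \<open>b\<close> are counted at positions up to \<open>n - 1 - x\<close>.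
  This partial degree explains the shift by $j-1$ in the Gotzmann summands.\<close>

lemma sum_expo_upto:
  assumes "set b \<subseteq> {x..<n}" "x < n"
  shows "mdeg (n - 1 - x) (expo n b) = length b"
proof -
  have "mdeg (n - 1 - x) (expo n b) = (\<Sum>y\<in>{x..<n}. count_list b y)"
    unfolding mdeg_def
    by (rule sum.reindex_bij_witness[where i = "\<lambda>y. n - 1 - y" and j = "\<lambda>k. n - 1 - k"])
      (use assms(2) in \<open>auto simp: expo_def\<close>)
  also have "\<dots> = length b" using assms(1) by (rule sum_count_set) simp
  finally show ?thesis .
qed

lemma gotzmann_snoc: "gotzmann (b @ [x]) t = gotzmann b t + ((t + real x - real (length b)) gchoose x)"
  by (simp add: gotzmann_def nth_append)

text \<open>Appending \<open>x\<close> to the decreasing list raises the exponent at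
  \<open>n - 1 - x\<close>, after which all exponents vanish. The complement gains one prefix
  cylinder, whose size in large degree is the new summand.\<close>

lemma has_hilb_poly_lexsat:
  assumes "sorted_wrt (\<ge>) b" "set b \<subseteq> {..<n}"
  shows "has_hilb_poly n (lexsat n (expo n b)) (gotzmann b)"
  using assms
proof (induction b rule: rev_induct)
  case Nil
  have "expo n [] = (\<lambda>k. 0)" by (auto simp: expo_def)
  then have "mons_deg n d - lexsat n (expo n []) = {}" for d
    by (auto simp: lexsat_def below_def mons_deg_def)
  then show ?case by (simp add: has_hilb_poly_def gotzmann_def hilb_fun_def)
next
  case (snoc x b)
  then have x: "x < n" and b: "set b \<subseteq> {x..<n}" by (auto simp: sorted_wrt_append)
  have IH: "\<forall>\<^sub>F d in sequentially. real (hilb_fun n (lexsat n (expo n b)) d) = gotzmann b (real d)"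
    using snoc by (simp add: has_hilb_poly_def sorted_wrt_append)
  let ?i = "n - 1 - x" and ?a = "expo n b"
  have i: "?i < n" "n - 1 - ?i = x" using x by auto
  have upd: "expo n (b @ [x]) = ?a(?i := ?a ?i + 1)"
    using x by (auto simp: expo_def fun_eq_iff)
  have zero: "?a k = 0" if "?i < k" "k < n" for k
    using that b x by (auto simp: expo_def count_list_0_iff subset_iff)
  have "real (hilb_fun n (lexsat n (expo n (b @ [x]))) d) = gotzmann (b @ [x]) (real d)"
    if "d \<ge> length b" and eq: "real (hilb_fun n (lexsat n ?a) d) = gotzmann b (real d)" for d
  proof -
    have "hilb_fun n (lexsat n (?a(?i := ?a ?i + 1))) d =
        hilb_fun n (lexsat n ?a) d + card {u \<in> mons_deg n d. \<forall>k\<le>?i. u k = ?a k}"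
      by (rule hilb_fun_lexsat_upd[OF i(1) zero])
    moreover have "card {u \<in> mons_deg n d. \<forall>k\<le>?i. u k = ?a k} = (d - length b + x choose x)"
      using card_prefix_eq[OF i(1), of ?a d] sum_expo_upto[OF b x] that(1) i(2) by simp
    ultimately have "hilb_fun n (lexsat n (expo n (b @ [x]))) d =
        hilb_fun n (lexsat n ?a) d + (d - length b + x choose x)"
      by (simp only: upd)
    then have "real (hilb_fun n (lexsat n (expo n (b @ [x]))) d) =
        gotzmann b (real d) + (real (d - length b + x) gchoose x)"
      using eq by (simp add: binomial_gbinomial)
    moreover have "real (d - length b + x) = real d + real x - real (length b)"
      using that(1) by simp
    ultimately show ?thesis by (simp add: gotzmann_snoc)
  qed
  then show ?case
    unfolding has_hilb_poly_def
    by (intro eventually_elim2[OF eventually_ge_at_top[of "length b"] IH])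
qed

text \<open>Inclusion and equal counts give equality in large degrees, and these determine a
  saturated ideal.\<close>

lemma saturated_subset_eq:
  assumes I: "mono_ideal n I" "saturated n I" and L: "mono_ideal n L" and sub: "I \<subseteq> L"
    and ev: "\<forall>\<^sub>F e in sequentially. hilb_fun n I e = hilb_fun n L e"
  shows "I = L"
proof
  show "L \<subseteq> I"
  proof
    fix u assume u: "u \<in> L"
    then have un: "u \<in> mons n" using L by (auto simp: mono_ideal_def)
    obtain N where N: "\<And>e. e \<ge> N \<Longrightarrow> hilb_fun n I e = hilb_fun n L e"
      using ev by (auto simp: eventually_sequentially)
    let ?e = "mdeg n u + N"
    have "card (mons_deg n ?e \<inter> I) = card (mons_deg n ?e \<inter> L)"
      using N[of ?e] hilb_fun_add_card[of n I ?e] hilb_fun_add_card[of n L ?e] by simp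
    then have eq: "mons_deg n ?e \<inter> I = mons_deg n ?e \<inter> L"
      using sub by (intro card_subset_eq) auto
    have "(\<lambda>i. u i + w i) \<in> I" if w: "w \<in> mons_deg n N" for w
    proof -
      have "(\<lambda>i. u i + w i) \<in> L" using mono_idealD[OF L u] w by (simp add: mons_deg_def)
      moreover have "(\<lambda>i. u i + w i) \<in> mons_deg n ?e"
        using w un by (simp add: mons_deg_def mdeg_add mons_add)
      ultimately show ?thesis using eq by blast
    qed
    then have "u \<in> saturation n I" using un by (auto simp: saturation_def)
    then show "u \<in> I" using I(2) by (simp add: saturated_def)
  qed
qed (rule sub)

lemma hilb_fun_antimono: "I \<subseteq> J \<Longrightarrow> hilb_fun n J d \<le> hilb_fun n I d"
  unfolding hilb_fun_def by (rule card_mono) auto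

text \<open>The ideals differ in such a degree by one monomial: the lowered prefix completed by a
  power of $x_{m+1}$.\<close>

lemma hilb_fun_lexsat_decr:
  assumes "0 < a m" "mdeg m (a(m := a m - 1)) \<le> d"
  shows "hilb_fun (Suc m) (lexsat (Suc m) a) d =
    hilb_fun (Suc m) (lexsat (Suc m) (a(m := a m - 1))) d + 1"
proof -
  let ?a = "a(m := a m - 1)"
  have "?a(m := ?a m + 1) = a" using assms(1) by auto
  then show ?thesis
    using hilb_fun_lexsat_upd[of m "Suc m" ?a d] card_prefix_one[OF assms(2)] by simp
qed

lemma mdeg_eq_head: "mdeg m u = u 0 + (\<Sum>k\<in>{1..<Suc m}. u k)"
proof -
  have "{..m} = insert 0 {1..<Suc m}" by auto
  then show ?thesis by (simp add: mdeg_def)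
qed

text \<open>Let an element of \<open>I\<close> leave \<open>a\<close> downwards at \<open>i\<close>.
  For \<open>i < m\<close>, \<open>a m\<close> uses up one of the two units, so at most one is left
  at positions 1 to \<open>i\<close> and \<open>bounded\<close> can be verified. For
  \<open>i = m\<close> the lowered exponents lie in \<open>I\<close>, their Borel closure contains
  \<open>lexsat n ?a\<close>, and \<open>I\<close> is too large by one monomial per degree.\<close>

lemma borel_subset_lexsat_small:
  assumes I: "mono_ideal n I" "borel n I" "saturated n I" and n: "n = Suc m"
    and am: "0 < a m" and small: "(\<Sum>k\<in>{1..<n}. a k) \<le> 2"
    and ev: "\<forall>\<^sub>F e in sequentially. hilb_fun n I e = hilb_fun n (lexsat n a) e"
  shows "I \<subseteq> lexsat n a"
proof (rule ccontr)
  assume "\<not> I \<subseteq> lexsat n a"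
  then obtain u where u: "u \<in> I" "u \<notin> lexsat n a" by blast
  have un: "u \<in> mons n" using u(1) I(1) by (auto simp: mono_ideal_def)
  have "below n a u" using u un by (simp add: lexsat_def)
  then obtain i where i: "i < n" "\<forall>k<i. u k = a k" "u i < a i" unfolding below_def by blast
  show False
  proof (cases "i < m")
    case True
    have "a i \<le> u i"
    proof (rule borel_exponent_ge[OF I(1,2) _ _ u(1) i(2)])
      show "\<forall>\<^sub>F e in sequentially. hilb_fun n (lexsat n a) e \<le> hilb_fun n I e"
        using ev by (rule eventually_mono) simp
      show "i + 1 < n" using True n by simp
      fix v assume v: "v \<in> mons n" "v \<notin> I" "\<not> below i a v" "\<exists>k<i. v k \<noteq> a k"
      then have "0 < i" by auto
      have sub: "{1..<Suc i} \<subseteq> {1..<n} - {m}" using True n by auto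
      have "(\<Sum>k\<in>{1..<Suc i}. a k) \<le> (\<Sum>k\<in>{1..<n} - {m}. a k)"
        using sub by (intro sum_mono2) auto
      moreover have "(\<Sum>k\<in>{1..<n}. a k) = a m + (\<Sum>k\<in>{1..<n} - {m}. a k)"
        using n True \<open>0 < i\<close> by (intro sum.remove) auto
      moreover have "(\<Sum>k\<in>{1..<Suc i}. a k) = (\<Sum>k\<in>{1..<i}. a k) + a i" using \<open>0 < i\<close> by simp
      ultimately have "(\<Sum>k\<in>{1..<i}. a k) + a i \<le> 1" using small am by simp
      then have ai: "u i = 0" and "(\<Sum>k\<in>{1..<i}. a k) = 0" using i(3) by linarith+
      then have az: "a k = 0" if "0 < k" "k < i" for k using that by simp
      have u0: "u 0 = a 0" using i(2) \<open>0 < i\<close> by simp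
      have v0: "a 0 \<le> v 0" using v(3) \<open>0 < i\<close> unfolding below_def by (metis less_nat_zero_code linorder_not_le)
      \<comment> \<open>Up to position \<open>i\<close>, \<open>u\<close> is just $x_0^{a_0}$; since
        \<open>a 0 \<le> v 0\<close>, a larger partial degree at \<open>i + 1\<close> would put
        \<open>v\<close> into \<open>I\<close> by dominance.\<close>
      show "mdeg (Suc i) v \<le> mdeg n u"
      proof (rule ccontr)
        assume big: "\<not> ?thesis"
        have "mdeg l u \<le> mdeg l v" if "l \<le> n" for l
        proof (cases "l \<le> i")
          case True
          have "u k \<le> v k" if "k \<le> l" for k
            using that True ai az u0 v0 i(2) by (cases "k = 0"; cases "k = i") auto
          then show ?thesis by (rule mdeg_mono)
        next
          case False
          have "mdeg l u \<le> mdeg n u" using that by (rule mdeg_le)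
          also have "\<dots> \<le> mdeg (Suc i) v" using big by simp
          also have "\<dots> \<le> mdeg l v" using False by (intro mdeg_le) simp
          finally show ?thesis .
        qed
        then show False using borel_dominance[OF I(1,2) u(1) v(1)] v(2) by blast
      qed
    qed
    then show False using i(3) by simp
  next
    case False
    then have im: "i = m" using i(1) n by simp
    let ?a = "a(m := a m - 1)"
    \<comment> \<open>\<open>a\<close> is unconstrained from \<open>n\<close> on, so it is cut off
      there to give a monomial.\<close>
    define w where "w k = (if k < n then ?a k else 0)" for k
    have w_mons: "w \<in> mons n" using n by (auto simp: w_def mons_def)
    have "u(n := 0) \<in> I" using saturated_borel_upd_last[OF I un] u(1) by simp
    then have wI: "w \<in> I"
    proof (rule mono_ideal_dvd[OF I(1) _ w_mons])
      fix k assume "k \<le> n"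
      then show "(u(n := 0)) k \<le> w k"
        using i im n by (cases k m rule: linorder_cases) (auto simp: w_def)
    qed
    \<comment> \<open>The bound 2 enters here: lowering \<open>a m\<close> leaves at most one unit
      besides $a_0$.\<close>
    have w_le: "mdeg l w \<le> a 0 + 1" if "l \<le> n" for l
    proof -
      have "mdeg l w \<le> mdeg n w" using that by (rule mdeg_le)
      also have "\<dots> = mdeg m w" using n by (intro mdeg_zero_after) (auto simp: w_def)
      also have "\<dots> \<le> a 0 + 1"
      proof (cases "m = 0")
        case True
        then show ?thesis by (simp add: mdeg_def w_def n)
      next
        case False
        have "(\<Sum>k\<in>{1..<n}. ?a k) = ?a m + (\<Sum>k\<in>{1..<n} - {m}. ?a k)"
          using n False by (intro sum.remove) auto
        also have "(\<Sum>k\<in>{1..<n} - {m}. ?a k) = (\<Sum>k\<in>{1..<n} - {m}. a k)"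
          by (rule sum.cong) auto
        finally have "(\<Sum>k\<in>{1..<n}. ?a k) + 1 = (\<Sum>k\<in>{1..<n}. a k)"
          using n False am sum.remove[of "{1..<n}" m a] by simp
        moreover have "(\<Sum>k\<in>{1..<Suc m}. w k) = (\<Sum>k\<in>{1..<n}. ?a k)"
          unfolding n by (rule sum.cong) (auto simp: w_def n)
        moreover have "w 0 = a 0" using False n by (simp add: w_def)
        ultimately show ?thesis using mdeg_eq_head[of m w] small by simp
      qed
      finally show ?thesis .
    qed
    have "lexsat n ?a \<subseteq> I"
    proof
      fix v assume "v \<in> lexsat n ?a"
      then have v: "v \<in> mons n" "\<not> below n ?a v" by (auto simp: lexsat_def)
      show "v \<in> I"
      proof (cases "\<exists>k<n. v k \<noteq> ?a k")
        case False
        show ?thesis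
        proof (rule mono_ideal_dvd[OF I(1) wI v(1)])
          fix k assume "k \<le> n"
          show "w k \<le> v k" using False unfolding w_def by (metis le0 order_refl)
        qed
      next
        case True
        then obtain k where k: "k < n" "\<forall>l<k. v l = ?a l" "?a k < v k"
          using first_difference[OF v(2)] by blast
        have pre: "w l \<le> v l" if "l \<le> k" for l
          using k(2)[rule_format, of l] k(1,3) that unfolding w_def by (cases "l = k") auto
        have "mdeg l w \<le> mdeg l v" if "l \<le> n" for l
        proof (cases "l < k")
          case True
          then show ?thesis using pre by (intro mdeg_mono) simp
        next
          case False
          have "mdeg k w < mdeg k v" unfolding mdeg_def
          proof (rule sum_strict_mono_ex1)
            show "\<exists>l\<in>{..k}. w l < v l" using k(1,3) by (intro bexI[of _ k]) (auto simp: w_def)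
          qed (use pre in auto)
          \<comment> \<open>An excess at \<open>k\<close> gives \<open>v\<close> partial degree at
            least \<open>a 0 + 1\<close>, which bounds that of \<open>w\<close> everywhere. For
            \<open>m = 0\<close> the lowered position is 0 itself, hence the separate case.\<close>
          moreover have "a 0 \<le> mdeg k w \<or> (k = 0 \<and> m = 0)"
            using k(1) n member_le_sum[of 0 "{..k}" w] unfolding mdeg_def w_def by (cases "m = 0") auto
          moreover have "mdeg l w \<le> mdeg k w" if "k = 0" "m = 0"
          proof -
            have "mdeg l w = mdeg 0 w" using that n by (intro mdeg_zero_after) (auto simp: w_def)
            then show ?thesis using that by simp
          qed
          moreover have "mdeg k v \<le> mdeg l v" using False by (intro mdeg_le) simp
          ultimately show ?thesis using w_le[OF that] by linarith
        qed
        then show ?thesis by (rule borel_dominance[OF I(1,2) wI v(1)])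
      qed
    qed
    then have le: "hilb_fun n I d \<le> hilb_fun n (lexsat n ?a) d" for d by (rule hilb_fun_antimono)
    obtain N where N: "\<And>e. e \<ge> N \<Longrightarrow> hilb_fun n I e = hilb_fun n (lexsat n a) e"
      using ev by (auto simp: eventually_sequentially)
    let ?d = "max N (mdeg m ?a)"
    have "hilb_fun n (lexsat n a) ?d = hilb_fun n (lexsat n ?a) ?d + 1"
      unfolding n by (rule hilb_fun_lexsat_decr[of a m, OF am]) simp
    then show False using le[of ?d] N[of ?d] by simp
  qed
qed

subsection \<open>A second Borel ideal\<close>

lemma mdeg_le_move:
  assumes "i < j" "j \<le> n" "0 < u j"
  shows "mdeg l u \<le> mdeg l (u(i := u i + 1, j := u j - 1))"
proof (cases "l < j")
  case True
  then show ?thesis by (intro mdeg_mono) auto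
next
  case False
  then show ?thesis using mdeg_move[of i j l u] assms by simp
qed

text \<open>The second ideal arises from the lexicographic one by adjoining the monomials that agree with
  the lowered exponents and removing those that agree with $\rho$; the latter are minimal
  for the Borel order.\<close>

lemma second_borel_ideal:
  assumes n: "n = Suc m" and am: "0 < a m" and big: "3 \<le> (\<Sum>k\<in>{1..<n}. a k)"
  shows "\<exists>I. mono_ideal n I \<and> borel n I \<and> saturated n I \<and> I \<noteq> lexsat n a
    \<and> (\<forall>\<^sub>F e in sequentially. hilb_fun n I e = hilb_fun n (lexsat n a) e)"
proof -
  let ?a = "a(m := a m - 1)"
  define p where "p = (LEAST k. 1 \<le> k \<and> 0 < a k)"
  have "m \<noteq> 0"
  proof
    assume "m = 0"
    then show False using big n by simp
  qed
  then have "1 \<le> m \<and> 0 < a m" using am by simp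
  then have "1 \<le> p \<and> 0 < a p" and pm: "p \<le> m"
    unfolding p_def by (rule LeastI, rule Least_le)
  then have p: "1 \<le> p" "0 < a p" by auto
  have a_zero: "a k = 0" if "1 \<le> k" "k < p" for k
    using that not_less_Least[of k "\<lambda>k. 1 \<le> k \<and> 0 < a k"] unfolding p_def by simp
  \<comment> \<open>This is $x_0^{a_0} x_{p-1}$, the monomial \<open>lexgen a (p - 1)\<close> of
    degree \<open>a 0 + 1\<close>. For \<open>p = 1\<close> both conditionals contribute at position
    0.\<close>
  define \<rho> where "\<rho> k = (if k = 0 then a 0 else 0) + (if k = p - 1 then 1 else 0)" for k
  \<comment> \<open>\<open>\<rho>\<close> times all powers of $x_n$: removing one monomial per large
    degree balances the one gained by lowering \<open>a m\<close>.\<close>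
  define R where "R = {u \<in> mons n. \<forall>k<n. u k = \<rho> k}"
  define I where "I = lexsat n ?a - R"
  have \<rho>_n: "\<rho> n = 0" using pm n by (simp add: \<rho>_def)
  have \<rho>_mons: "\<rho> \<in> mons n" using pm n by (simp add: \<rho>_def mons_def)
  have \<rho>_pre: "\<rho> k = a k" if "k < p - 1" for k
    using that a_zero[of k] by (cases "k = 0") (auto simp: \<rho>_def)
  have \<rho>_p: "a (p - 1) < \<rho> (p - 1)"
    using p a_zero[of "p - 1"] by (cases "p = 1") (auto simp: \<rho>_def)
  have mdeg_\<rho>: "mdeg l \<rho> \<le> a 0 + 1" for l
    by (simp add: \<rho>_def mdeg_def sum.distrib sum.delta)

  \<comment> \<open>The threshold 3 enters here: two units remain from \<open>p\<close> on after
    lowering, one more than a monomial of degree \<open>a 0 + 1\<close> containing $x_0^{a_0}$ can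
    match.\<close>
  have a_big: "2 \<le> (\<Sum>k\<in>{p..<n}. ?a k)"
  proof -
    have "(\<Sum>k\<in>{1..<n}. a k) = (\<Sum>k\<in>{p..<n}. a k)"
      using p(1) a_zero by (intro sum.mono_neutral_right) auto
    moreover have "(\<Sum>k\<in>{p..<n}. a k) = a m + (\<Sum>k\<in>{p..<n} - {m}. a k)"
      using pm n by (intro sum.remove) auto
    moreover have "(\<Sum>k\<in>{p..<n}. ?a k) = ?a m + (\<Sum>k\<in>{p..<n} - {m}. ?a k)"
      using pm n by (intro sum.remove) auto
    moreover have "(\<Sum>k\<in>{p..<n} - {m}. ?a k) = (\<Sum>k\<in>{p..<n} - {m}. a k)"
      by (rule sum.cong) auto
    ultimately show ?thesis using big by simp
  qed

  \<comment> \<open>To be below, \<open>v\<close> must have no surplus before its first shortage. If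
    that shortage lies after \<open>p\<close>, the only unit of \<open>v\<close> on the tail sits at
    \<open>p\<close>, where \<open>?a p \<ge> 1\<close> absorbs it.\<close>
  have tail_below: "below n ?a v"
    if pre: "\<And>k. k < p \<Longrightarrow> v k = a k" and small: "(\<Sum>k\<in>{p..<n}. v k) \<le> 1" for v
  proof -
    have "\<exists>k\<in>{p..<n}. v k < ?a k"
    proof (rule ccontr)
      assume "\<not> ?thesis"
      then have "(\<Sum>k\<in>{p..<n}. ?a k) \<le> (\<Sum>k\<in>{p..<n}. v k)"
        by (intro sum_mono) (meson linorder_not_le)
      then show False using a_big small by simp
    qed
    then have ex: "\<exists>k. p \<le> k \<and> k < n \<and> v k < ?a k" by auto
    define k where "k = (LEAST k. p \<le> k \<and> k < n \<and> v k < ?a k)"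
    have k: "p \<le> k" "k < n" "v k < ?a k" using LeastI_ex[OF ex] unfolding k_def by auto
    have ge: "?a l \<le> v l" if "p \<le> l" "l < k" for l
      using that k(2) not_less_Least[of l "\<lambda>k. p \<le> k \<and> k < n \<and> v k < ?a k"]
      unfolding k_def by (meson linorder_not_le less_trans)
    have "v l \<le> ?a l" if "l < k" for l
    proof (cases "l < p")
      case True
      then show ?thesis using pre[of l] pm by simp
    next
      case False
      have ap: "1 \<le> ?a p" if "p < m" using that p by simp
      have "1 \<le> v p"
      proof -
        have "p < m" using False that k(2) n by simp
        then show ?thesis using ge[of p] ap that False by simp
      qed
      moreover have "v p + (\<Sum>k\<in>{p..<n} - {p}. v k) \<le> 1"
        using small pm n sum.remove[of "{p..<n}" p v] by simp
      ultimately have vp: "v p = 1" and "(\<Sum>k\<in>{p..<n} - {p}. v k) = 0" by linarith+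
      then have "\<forall>k\<in>{p..<n} - {p}. v k = 0" by simp
      then have "v l = 0" if "l \<noteq> p" using that False \<open>l < k\<close> k(2) by simp
      moreover have "v p \<le> ?a p" using vp ap False that k(2) n by simp
      ultimately show ?thesis by (cases "l = p") auto
    qed
    then show ?thesis using k by (intro belowI[of k]) auto
  qed

  \<comment> \<open>Borel steps towards \<open>\<rho>\<close> start from smaller partial degrees;
    index \<open>n\<close> is left out because powers of $x_n$ are free. A different monomial
    keeping $x_0^{a_0}$ has lost the extra $x_{p-1}$, and the one unit it can spend later is too
    little for the tail of \<open>?a\<close>.\<close>
  have \<rho>_minimal: "below n ?a v"
    if le: "\<And>l. l < n \<Longrightarrow> mdeg l v \<le> mdeg l \<rho>" and neq: "\<exists>l<n. v l \<noteq> \<rho> l" for v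
  proof -
    define l where "l = (LEAST l. v l \<noteq> \<rho> l)"
    have l: "v l \<noteq> \<rho> l" unfolding l_def using neq LeastI_ex[of "\<lambda>l. v l \<noteq> \<rho> l"] by blast
    have ln: "l < n" unfolding l_def using neq Least_le[of "\<lambda>l. v l \<noteq> \<rho> l"] by (meson le_less_trans)
    have eq: "v k = \<rho> k" if "k < l" for k
      using that not_less_Least[of k "\<lambda>l. v l \<noteq> \<rho> l"] unfolding l_def by blast
    have "v l < \<rho> l"
    proof (cases l)
      case 0
      then show ?thesis using le[of 0] l n by (simp add: mdeg_def)
    next
      case (Suc k)
      have "mdeg k v = mdeg k \<rho>" using eq Suc by (intro mdeg_cong) simp
      then show ?thesis using le[OF ln] l Suc by (simp add: mdeg_Suc)
    qed
    have sum_le: "mdeg m v \<le> a 0 + 1" using le[of m] mdeg_\<rho>[of m] n by simp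
    have split: "mdeg m v = (\<Sum>k<p. v k) + (\<Sum>k\<in>{p..<n}. v k)"
      unfolding mdeg_def n lessThan_Suc_atMost[symmetric]
      using sum.atLeastLessThan_concat[of 0 p "Suc m" v] pm by (simp add: atLeast0LessThan)
    show ?thesis
    proof (cases "v 0 < a 0")
      case True
      then show ?thesis using n \<open>m \<noteq> 0\<close> by (intro belowI[of 0]) auto
    next
      case False
      have lp: "l = p - 1"
        using \<open>v l < \<rho> l\<close> False by (cases "l = 0") (auto simp: \<rho>_def split: if_splits)
      have pre: "v k = a k" if "k < p" for k
      proof (cases "k = p - 1")
        case True
        then show ?thesis using \<open>v l < \<rho> l\<close> lp False a_zero[of k] p(1)
          by (cases "k = 0") (auto simp: \<rho>_def)
      next
        case False
        then show ?thesis using that eq[of k] \<rho>_pre[of k] lp by simp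
      qed
      have "a 0 \<le> (\<Sum>k<p. v k)"
        using member_le_sum[of 0 "{..<p}" v] pre[of 0] p(1) by simp
      then have "(\<Sum>k\<in>{p..<n}. v k) \<le> 1" using sum_le split by simp
      then show ?thesis using pre by (intro tail_below)
    qed
  qed

  have not_R: "w \<notin> R"
    if u: "u \<in> I" and le: "\<And>l. mdeg l u \<le> mdeg l w" and neq: "w \<in> R \<Longrightarrow> \<exists>k<n. u k \<noteq> w k" for u w
  proof
    assume w: "w \<in> R"
    have "mdeg l u \<le> mdeg l \<rho>" if "l < n" for l
    proof -
      have "mdeg l w = mdeg l \<rho>" using w that by (intro mdeg_cong) (auto simp: R_def)
      then show ?thesis using le[of l] by simp
    qed
    moreover have "\<exists>l<n. u l \<noteq> \<rho> l" using neq[OF w] w unfolding R_def by auto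
    ultimately have "below n ?a u" by (rule \<rho>_minimal)
    then show False using u by (simp add: I_def lexsat_def)
  qed
  have mono: "mono_ideal n I"
  proof (rule mono_idealI)
    show "I \<subseteq> mons n" by (auto simp: I_def lexsat_def)
    fix u i assume u: "u \<in> I" "i \<le> n"
    let ?w = "u(i := u i + 1)"
    have "\<exists>k<n. u k \<noteq> ?w k" if "?w \<in> R"
    proof (cases "i = n")
      \<comment> \<open>Multiplying by $x_n$ alters no exponent before \<open>n\<close>, so
        \<open>u\<close> would already lie in \<open>R\<close>.\<close>
      case True
      have "u \<notin> R" "u \<in> mons n" using u by (auto simp: I_def lexsat_def)
      then show ?thesis using that True by (auto simp: R_def)
    next
      case False
      then show ?thesis using u by (intro exI[of _ i]) auto
    qed
    then have "?w \<notin> R" by (intro not_R[OF u(1)]) (auto intro: mdeg_mono)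
    moreover have "?w \<in> lexsat n ?a"
      using mono_ideal_incr[OF lexsat_mono_ideal, of u] u by (simp add: I_def)
    ultimately show "?w \<in> I" by (simp add: I_def)
  qed
  have borel: "borel n I"
    unfolding borel_def
  proof (intro ballI allI impI, elim conjE)
    fix u i j assume u: "u \<in> I" and ij: "i < j" "j \<le> n" "0 < u j"
    let ?w = "u(i := u i + 1, j := u j - 1)"
    have "?w \<notin> R"
    proof (rule not_R[OF u])
      show "mdeg l u \<le> mdeg l ?w" for l using ij by (rule mdeg_le_move)
      show "\<exists>k<n. u k \<noteq> ?w k" using ij by (intro exI[of _ i]) auto
    qed
    moreover have "?w \<in> lexsat n ?a"
      using u ij by (intro borel_move[OF lexsat_borel]) (auto simp: I_def)
    ultimately show "?w \<in> I" by (simp add: I_def)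
  qed
  have sat: "saturated n I"
  proof (rule saturatedI[OF mono])
    fix u x assume u: "u \<in> mons n" and ux: "u(n := x) \<in> I"
    then have "u \<in> lexsat n ?a" using lexsat_upd_last[OF u] by (simp add: I_def)
    moreover have "u \<notin> R" using ux u by (auto simp: I_def R_def mons_upd)
    ultimately show "u \<in> I" by (simp add: I_def)
  qed
  \<comment> \<open>Needed for \<open>a\<close>, to tell the two ideals apart, and for
    \<open>?a\<close>, to see that \<open>R\<close> lies in the ideal from which it is
    removed.\<close>
  have \<rho>_lex: "\<not> below n a' \<rho>" if "\<And>k. k < p \<Longrightarrow> a' k = a k" for a'
    using \<rho>_pre \<rho>_p that p(1) by (intro not_below_if_greater[of "p - 1"]) auto
  have "\<rho> \<in> lexsat n a" using \<rho>_lex[of a] \<rho>_mons by (simp add: lexsat_def)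
  moreover have "\<rho> \<notin> I" using \<rho>_mons by (simp add: I_def R_def)
  ultimately have neq: "I \<noteq> lexsat n a" by blast
  have "\<not> below n ?a \<rho>" using pm by (intro \<rho>_lex) auto
  then have R_sub: "R \<subseteq> lexsat n ?a"
    using below_cong[of n _ \<rho> ?a] by (auto simp: R_def lexsat_def)
  have "hilb_fun n I d = hilb_fun n (lexsat n a) d"
    if d: "mdeg m \<rho> \<le> d" "mdeg m ?a \<le> d" for d
  proof -
    let ?A = "mons_deg n d - lexsat n ?a" and ?B = "{u \<in> mons_deg n d. \<forall>k\<le>m. u k = \<rho> k}"
    have B: "?B = mons_deg n d \<inter> R"
      by (auto simp: R_def n less_Suc_eq_le mons_deg_def)
    have "mons_deg n d - I = ?A \<union> ?B" using R_sub unfolding B I_def by blast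
    moreover have "?A \<inter> ?B = {}" using R_sub unfolding B by blast
    ultimately have "hilb_fun n I d = hilb_fun n (lexsat n ?a) d + card ?B"
      unfolding hilb_fun_def by (simp add: card_Un_disjoint)
    then show ?thesis
      using card_prefix_one[OF d(1)] hilb_fun_lexsat_decr[of a m d, OF am d(2)] n by simp
  qed
  then have "\<forall>\<^sub>F d in sequentially. hilb_fun n I d = hilb_fun n (lexsat n a) d"
    unfolding eventually_sequentially by (intro exI[of _ "max (mdeg m \<rho>) (mdeg m ?a)"]) simp
  then show ?thesis using mono borel sat neq by blast
qed

subsection \<open>Uniqueness\<close>

text \<open>\<open>lexsat n a\<close> itself shows that the choice in \<open>lex_ideal\<close>
  succeeds, and \<open>saturation_lexify\<close> applies to whatever was chosen.\<close>

lemma lex_ideal_eq_lexsat: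
  assumes "has_hilb_poly n (lexsat n a) P"
  shows "lex_ideal n P = lexsat n a"
proof -
  let ?J = "SOME J. mono_ideal n J \<and> has_hilb_poly n J P"
  have "mono_ideal n ?J \<and> has_hilb_poly n ?J P"
    by (rule someI[of _ "lexsat n a"]) (use assms lexsat_mono_ideal in simp)
  then have mono: "mono_ideal n ?J" and
    ev: "\<forall>\<^sub>F d in sequentially. real (hilb_fun n ?J d) = P (real d)"
    by (auto simp: has_hilb_poly_def)
  have "\<forall>\<^sub>F d in sequentially. hilb_fun n ?J d = hilb_fun n (lexsat n a) d"
    by (rule eventually_elim2[OF ev assms[unfolded has_hilb_poly_def]]) simp
  then show ?thesis unfolding lex_ideal_def by (rule saturation_lexify[OF mono])
qed

lemma unique_saturated_borel_iff:
  assumes n: "n = Suc m" and P: "has_hilb_poly n (lexsat n a) P"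
  shows "{I. mono_ideal n I \<and> borel n I \<and> saturated n I \<and> has_hilb_poly n I P} = {lexsat n a}
    \<longleftrightarrow> a m = 0 \<or> (\<Sum>k\<in>{1..<n}. a k) \<le> 2"
proof -
  let ?L = "lexsat n a"
  have HP: "has_hilb_poly n I P \<longleftrightarrow> (\<forall>\<^sub>F d in sequentially. hilb_fun n I d = hilb_fun n ?L d)" for I
    unfolding has_hilb_poly_def
    by (rule eventually_cong[OF P[unfolded has_hilb_poly_def]]) auto
  have L: "mono_ideal n ?L \<and> borel n ?L \<and> saturated n ?L \<and> has_hilb_poly n ?L P"
    using lexsat_mono_ideal lexsat_borel lexsat_saturated P by blast
  show ?thesis
  proof
    assume uniq: "{I. mono_ideal n I \<and> borel n I \<and> saturated n I \<and> has_hilb_poly n I P} = {?L}"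
    show "a m = 0 \<or> (\<Sum>k\<in>{1..<n}. a k) \<le> 2"
    proof (rule ccontr)
      assume "\<not> ?thesis"
      then have "0 < a m" "3 \<le> (\<Sum>k\<in>{1..<n}. a k)" by auto
      then show False using second_borel_ideal[OF n] uniq HP by blast
    qed
  next
    assume good: "a m = 0 \<or> (\<Sum>k\<in>{1..<n}. a k) \<le> 2"
    have "I = ?L" if I: "mono_ideal n I" "borel n I" "saturated n I" and "has_hilb_poly n I P" for I
    proof (rule saturated_subset_eq[OF I(1,3) lexsat_mono_ideal])
      show ev: "\<forall>\<^sub>F d in sequentially. hilb_fun n I d = hilb_fun n ?L d"
        using HP \<open>has_hilb_poly n I P\<close> by blast
      show "I \<subseteq> ?L"
      proof (cases "a m = 0")
        case True
        show ?thesis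
          by (rule borel_subset_lexsat[OF I(1,2) n]) (simp_all add: True hilb_fun_eq_lexsat[OF I n _ ev])
      next
        case False
        then show ?thesis using borel_subset_lexsat_small[OF I n _ _ ev] good by simp
      qed
    qed
    then show "{I. mono_ideal n I \<and> borel n I \<and> saturated n I \<and> has_hilb_poly n I P} = {?L}"
      using L by blast
  qed
qed

theorem theorem7p4:
  fixes b :: "nat list" and c n s :: nat
  assumes "b \<noteq> []"
    and "sorted_wrt (\<ge>) b"
    and "c > 0"
    and "n = c + b ! 0"
    and "s = card {j. j < length b \<and> b ! j = b ! 0}"
  shows "({I. mono_ideal n I \<and> borel n I \<and> saturated n I \<and> has_hilb_poly n I (gotzmann b)}
            = {lex_ideal n (gotzmann b)})
     \<longleftrightarrow> ((c \<ge> 2 \<and> (last b > 0 \<or> length b \<le> 2))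
          \<or> (c = 1 \<and> (last b > 0 \<or> b ! 0 = last b \<or> length b - s \<le> 2)))"
proof -
  define m where "m = n - 1"
  have n: "n = Suc m" using assms(3,4) by (simp add: m_def)
  have le_head: "x \<le> b ! 0" if "x \<in> set b" for x
    using assms(2) that by (cases b) auto
  have ge_last: "last b \<le> x" if "x \<in> set b" for x
    using assms(2) that by (induction b rule: rev_induct) (auto simp: sorted_wrt_append)
  have set_b: "set b \<subseteq> {..<n}" using le_head assms(3,4) by fastforce
  have P: "has_hilb_poly n (lexsat n (expo n b)) (gotzmann b)"
    by (rule has_hilb_poly_lexsat[OF assms(2) set_b])
  have "0 \<in> set b \<longleftrightarrow> last b = 0"
    using ge_last[of 0] last_in_set[OF assms(1)] by auto
  moreover have "expo n b m = count_list b 0" unfolding expo_def by (simp add: n)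
  ultimately have last0: "expo n b m = 0 \<longleftrightarrow> last b > 0"
    by (simp add: count_list_0_iff)
  have "mdeg m (expo n b) = length b"
    using sum_expo_upto[of b 0 n] set_b n by (simp add: lessThan_atLeast0)
  then have total: "expo n b 0 + (\<Sum>k\<in>{1..<n}. expo n b k) = length b"
    using mdeg_eq_head[of m "expo n b"] n by simp
  \<comment> \<open>Position 0 counts the entries equal to \<open>n - 1 = b ! 0 + (c - 1)\<close>:
    the \<open>s\<close> leading ones if \<open>c = 1\<close>, none otherwise.\<close>
  have head: "expo n b 0 = (if c = 1 then s else 0)"
  proof (cases "c = 1")
    case True
    then have "expo n b 0 = count_list b (b ! 0)" using assms(4) by (simp add: expo_def)
    also have "\<dots> = s"
      unfolding assms(5) count_list_eq_length_filter length_filter_conv_card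
      by (intro arg_cong[of _ _ card]) auto
    finally show ?thesis using True by simp
  next
    case False
    then have "n - 1 \<notin> set b" using le_head assms(3,4) by fastforce
    then show ?thesis using False by (simp add: expo_def count_list_0_iff)
  qed
  \<comment> \<open>Places the alternative \<open>b ! 0 = last b\<close> under the bound on
    \<open>length b - s\<close>: all entries are then leading ones.\<close>
  have all_eq: "length b - s = 0" if "b ! 0 = last b"
  proof -
    have "b ! j = b ! 0" if "j < length b" for j
      using le_head[of "b ! j"] ge_last[of "b ! j"] that \<open>b ! 0 = last b\<close> by simp
    then have "{j. j < length b \<and> b ! j = b ! 0} = {..<length b}" by auto
    then show ?thesis by (simp add: assms(5))
  qed
  have "(\<Sum>k\<in>{1..<n}. expo n b k) = length b - (if c = 1 then s else 0)"
    using total head by linarith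
  then show ?thesis
    unfolding lex_ideal_eq_lexsat[OF P] unique_saturated_borel_iff[OF n P] last0
    using assms(3) all_eq by auto
qed

end
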